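(* Let $X\subset\mathbb{R}^d$ be compact, let $Y\subset\mathbb{R}$ be non-empty and closed, let $p\ge 1$, and let $L:Y\times\mathbb{R}\to[0,\infty)$ be an invariant, convex loss function of lower and upper order $p$. Let $H$ be the reproducing kernel Hilbert space (RKHS) of a universal kernel on $X$. Define $p^*:=\max\{2p,p^2\}$ and fix a sequence $(\lambda_n)\subset(0,\infty)$ with $\lambda_n\to0$ and $\lambda_n^{p^*}n\to\infty$. For each $n\ge1$ and each sample $((x_1,y_1),\dots,(x_n,y_n))\in(X\times Y)^n$, let $\hat f_{n,\lambda_n}\in H$ be the unique minimizer over $f\in H$ of $$\frac1n\sum_{i=1}^nL(y_i,f(x_i))+\lambda_n\|f\|_H^2 .$$ Then for every probability distribution $\mathrm{P}$ on $X\times Y$ with $|\mathrm{P}|_p<\infty$, the estimator $\hat f_{n,\lambda_n}$ is $L$-risk consistent for $\mathrm{P}$, that is, for samples drawn i.i.d. from $\mathrm{P}$, $$\mathcal{R}_{L,\mathrm{P}}(\hat f_{n,\lambda_n})\to\mathcal{R}^*_{L,\mathrm{P}}\quad\text{in probability as } n\to\infty .$$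
   Context: A loss function is a measurable $L:Y\times\mathbb{R}\to[0,\infty)$. It is convex if $L(y,\cdot)$ is convex for every $y\in Y$. It is invariant if there is a function $l:\mathbb{R}\to[0,\infty)$ with $l(0)=0$ and $L(y,t)=l(y-t)$ for all $y\in Y$, $t\in\mathbb{R}$. An invariant loss is of upper order $p$ if there is $c>0$ with $l(r)\le c(|r|^p+1)$ for all $r\in\mathbb{R}$, and of lower order $p$ if there is $c>0$ with $l(r)\ge c(|r|^p-1)$ for all $r\in\mathbb{R}$. For a probability distribution $\mathrm{P}$ on $X\times Y$ and measurable $f:X\to\mathbb{R}$, the $L$-risk is $\mathcal{R}_{L,\mathrm{P}}(f):=\mathbb{E}_{\mathrm{P}}L(Y,f(X))$, where $(X,Y)\sim\mathrm{P}$, and $\mathcal{R}^*_{L,\mathrm{P}}:=\inf\{\mathcal{R}_{L,\mathrm{P}}(f): f:X\to\mathbb{R}\text{ measurable}\}$. Moreover $|\mathrm{P}|_p:=\int_{X\times Y}|y|^p\,d\mathrm{P}(x,y)$. A continuous kernel $k$ on a compact set $X\subset\mathbb{R}^d$ (a symmetric positive semidefinite function $k:X\times X\to\mathbb{R}$) is universal if its RKHS is dense in $(C(X),\|\cdot\|_\infty)$. *)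

theory Defs
  imports "HOL-Probability.Probability"
begin

subsection \<open>Loss functions\<close>

definition loss_function :: "real set \<Rightarrow> (real \<Rightarrow> real \<Rightarrow> real) \<Rightarrow> bool" where
  "loss_function Y L \<longleftrightarrow>
     (\<lambda>(y, t). L y t) \<in> borel_measurable (restrict_space borel (Y \<times> UNIV)) \<and>
     (\<forall>y\<in>Y. \<forall>t. 0 \<le> L y t)"

definition convex_loss :: "real set \<Rightarrow> (real \<Rightarrow> real \<Rightarrow> real) \<Rightarrow> bool" where
  "convex_loss Y L \<longleftrightarrow> (\<forall>y\<in>Y. convex_on UNIV (L y))"

definition represents_loss :: "real set \<Rightarrow> (real \<Rightarrow> real \<Rightarrow> real) \<Rightarrow> (real \<Rightarrow> real) \<Rightarrow> bool" where
  "represents_loss Y L l \<longleftrightarrow>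
     l 0 = 0 \<and> (\<forall>r. 0 \<le> l r) \<and> (\<forall>y\<in>Y. \<forall>t. L y t = l (y - t))"

definition invariant_loss :: "real set \<Rightarrow> (real \<Rightarrow> real \<Rightarrow> real) \<Rightarrow> bool" where
  "invariant_loss Y L \<longleftrightarrow> (\<exists>l. represents_loss Y L l)"

text \<open>
  If \<open>Y\<close> is non-empty, the function \<open>l\<close> representing an invariant loss is uniquely determined, so
  the existential quantifiers over \<open>l\<close> in the next two definitions refer to the same function.
\<close>

definition upper_order :: "real set \<Rightarrow> (real \<Rightarrow> real \<Rightarrow> real) \<Rightarrow> real \<Rightarrow> bool" where
  "upper_order Y L p \<longleftrightarrow>
     (\<exists>l. represents_loss Y L l \<and> (\<exists>c>0. \<forall>r. l r \<le> c * (\<bar>r\<bar> powr p + 1)))"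

definition lower_order :: "real set \<Rightarrow> (real \<Rightarrow> real \<Rightarrow> real) \<Rightarrow> real \<Rightarrow> bool" where
  "lower_order Y L p \<longleftrightarrow>
     (\<exists>l. represents_loss Y L l \<and> (\<exists>c>0. \<forall>r. l r \<ge> c * (\<bar>r\<bar> powr p - 1)))"


subsection \<open>Distributions and risks\<close>

definition distribution_on :: "'a::topological_space set \<Rightarrow> real set \<Rightarrow> ('a \<times> real) measure \<Rightarrow> bool" where
  "distribution_on X Y P \<longleftrightarrow>
     prob_space P \<and> space P = X \<times> Y \<and> sets P = sets (restrict_space borel (X \<times> Y))"

definition moment :: "real \<Rightarrow> ('a \<times> real) measure \<Rightarrow> ennreal" where
  "moment p P = (\<integral>\<^sup>+ z. ennreal (\<bar>snd z\<bar> powr p) \<partial>P)"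

definition risk :: "(real \<Rightarrow> real \<Rightarrow> real) \<Rightarrow> ('a \<times> real) measure \<Rightarrow> ('a \<Rightarrow> real) \<Rightarrow> ennreal" where
  "risk L P f = (\<integral>\<^sup>+ z. ennreal (L (snd z) (f (fst z))) \<partial>P)"

definition bayes_risk ::
  "'a::topological_space set \<Rightarrow> (real \<Rightarrow> real \<Rightarrow> real) \<Rightarrow> ('a \<times> real) measure \<Rightarrow> ennreal" where
  "bayes_risk X L P = (INF f\<in>borel_measurable (restrict_space borel X). risk L P f)"


subsection \<open>Kernels and reproducing kernel Hilbert spaces\<close>

definition kernel_on :: "'a set \<Rightarrow> ('a \<Rightarrow> 'a \<Rightarrow> real) \<Rightarrow> bool" where
  "kernel_on X k \<longleftrightarrow>
     (\<forall>x\<in>X. \<forall>x'\<in>X. k x x' = k x' x) \<and>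
     (\<forall>(n::nat) x a. (\<forall>i<n. x i \<in> X) \<longrightarrow> 0 \<le> (\<Sum>i<n. \<Sum>j<n. a i * a j * k (x i) (x j)))"

definition hnorm :: "(('a \<Rightarrow> real) \<Rightarrow> ('a \<Rightarrow> real) \<Rightarrow> real) \<Rightarrow> ('a \<Rightarrow> real) \<Rightarrow> real" where
  "hnorm ip f = sqrt (ip f f)"

text \<open>
  A function \<open>X \<rightarrow> \<real>\<close> is encoded as a total function that vanishes outside \<open>X\<close>, so that each such
  function has exactly one representative and the linear operations are pointwise. The values of
  the inner product \<open>ip\<close> matter only on \<open>H\<close>.
\<close>

locale hilbert_function_space =
  fixes X :: "'a set"
    and H :: "('a \<Rightarrow> real) set"
    and ip :: "('a \<Rightarrow> real) \<Rightarrow> ('a \<Rightarrow> real) \<Rightarrow> real"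
  assumes vanishing: "\<And>f x. f \<in> H \<Longrightarrow> x \<notin> X \<Longrightarrow> f x = 0"
    and zero_mem: "(\<lambda>x. 0) \<in> H"
    and add_mem: "\<And>f g. f \<in> H \<Longrightarrow> g \<in> H \<Longrightarrow> (\<lambda>x. f x + g x) \<in> H"
    and scale_mem: "\<And>c f. f \<in> H \<Longrightarrow> (\<lambda>x. c * f x) \<in> H"
    and ip_sym: "\<And>f g. f \<in> H \<Longrightarrow> g \<in> H \<Longrightarrow> ip f g = ip g f"
    and ip_add: "\<And>f g h. f \<in> H \<Longrightarrow> g \<in> H \<Longrightarrow> h \<in> H \<Longrightarrow> ip (\<lambda>x. f x + g x) h = ip f h + ip g h"
    and ip_scale: "\<And>c f g. f \<in> H \<Longrightarrow> g \<in> H \<Longrightarrow> ip (\<lambda>x. c * f x) g = c * ip f g"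
    and ip_nonneg: "\<And>f. f \<in> H \<Longrightarrow> 0 \<le> ip f f"
    and ip_definite: "\<And>f. f \<in> H \<Longrightarrow> ip f f = 0 \<Longrightarrow> f = (\<lambda>x. 0)"
    and complete: "\<And>F :: nat \<Rightarrow> 'a \<Rightarrow> real. (\<And>n. F n \<in> H) \<Longrightarrow>
          (\<forall>e>0. \<exists>N. \<forall>m\<ge>N. \<forall>n\<ge>N. hnorm ip (\<lambda>x. F m x - F n x) < e) \<Longrightarrow>
          \<exists>f\<in>H. (\<lambda>n. hnorm ip (\<lambda>x. F n x - f x)) \<longlonglongrightarrow> 0"

definition kernel_section :: "'a set \<Rightarrow> ('a \<Rightarrow> 'a \<Rightarrow> real) \<Rightarrow> 'a \<Rightarrow> 'a \<Rightarrow> real" where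
  "kernel_section X k x = (\<lambda>x'. if x' \<in> X then k x' x else 0)"

locale rkhs = hilbert_function_space X H ip
  for X :: "'a set"
    and k :: "'a \<Rightarrow> 'a \<Rightarrow> real"
    and H :: "('a \<Rightarrow> real) set"
    and ip :: "('a \<Rightarrow> real) \<Rightarrow> ('a \<Rightarrow> real) \<Rightarrow> real" +
  assumes kernel: "kernel_on X k"
    and section_mem: "\<And>x. x \<in> X \<Longrightarrow> kernel_section X k x \<in> H"
    and reproducing: "\<And>f x. f \<in> H \<Longrightarrow> x \<in> X \<Longrightarrow> f x = ip f (kernel_section X k x)"

definition universal_rkhs :: "'a::topological_space set \<Rightarrow> ('a \<Rightarrow> 'a \<Rightarrow> real) \<Rightarrow>
    ('a \<Rightarrow> real) set \<Rightarrow> (('a \<Rightarrow> real) \<Rightarrow> ('a \<Rightarrow> real) \<Rightarrow> real) \<Rightarrow> bool" where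
  "universal_rkhs X k H ip \<longleftrightarrow>
     rkhs X k H ip \<and>
     continuous_on (X \<times> X) (\<lambda>(x, x'). k x x') \<and>
     (\<forall>f\<in>H. continuous_on X f) \<and>
     (\<forall>g. continuous_on X g \<longrightarrow> (\<forall>e>0. \<exists>f\<in>H. \<forall>x\<in>X. \<bar>f x - g x\<bar> < e))"


subsection \<open>Regularized empirical risk minimization\<close>

text \<open>A sample of size \<open>n\<close> is a function \<open>z\<close>, of which only the values \<open>z i\<close> with \<open>i < n\<close> matter.\<close>

definition reg_emp_risk :: "(real \<Rightarrow> real \<Rightarrow> real) \<Rightarrow> (('a \<Rightarrow> real) \<Rightarrow> ('a \<Rightarrow> real) \<Rightarrow> real) \<Rightarrow>
    real \<Rightarrow> nat \<Rightarrow> (nat \<Rightarrow> 'a \<times> real) \<Rightarrow> ('a \<Rightarrow> real) \<Rightarrow> real" where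
  "reg_emp_risk L ip lam n z f =
     1 / real n * (\<Sum>i<n. L (snd (z i)) (f (fst (z i)))) + lam * (hnorm ip f)\<^sup>2"

definition reg_minimizer :: "(real \<Rightarrow> real \<Rightarrow> real) \<Rightarrow> ('a \<Rightarrow> real) set \<Rightarrow>
    (('a \<Rightarrow> real) \<Rightarrow> ('a \<Rightarrow> real) \<Rightarrow> real) \<Rightarrow> real \<Rightarrow> nat \<Rightarrow> (nat \<Rightarrow> 'a \<times> real) \<Rightarrow> ('a \<Rightarrow> real) \<Rightarrow> bool" where
  "reg_minimizer L H ip lam n z f \<longleftrightarrow>
     f \<in> H \<and> (\<forall>g\<in>H. reg_emp_risk L ip lam n z f \<le> reg_emp_risk L ip lam n z g)"

definition svm :: "(real \<Rightarrow> real \<Rightarrow> real) \<Rightarrow> ('a \<Rightarrow> real) set \<Rightarrow>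
    (('a \<Rightarrow> real) \<Rightarrow> ('a \<Rightarrow> real) \<Rightarrow> real) \<Rightarrow> real \<Rightarrow> nat \<Rightarrow> (nat \<Rightarrow> 'a \<times> real) \<Rightarrow> 'a \<Rightarrow> real" where
  "svm L H ip lam n z = (THE f. reg_minimizer L H ip lam n z f)"


subsection \<open>Risk consistency\<close>

text \<open>
  A sample of size \<open>n\<close> drawn i.i.d. from \<open>P\<close> has law \<open>\<Pi>\<^sub>M i\<in>{..<n}. P\<close>. Measurability of the risk is part
  of the notion, as \<^const>\<open>measure\<close> is 0 on non-measurable sets. The difference is formed in the
  extended reals, where \<open>\<bar>\<infinity> - \<infinity>\<bar> = \<infinity>\<close>, so that an infinite risk never counts as close to the
  Bayes risk.
\<close>

definition risk_consistent :: "'a::topological_space set \<Rightarrow> (real \<Rightarrow> real \<Rightarrow> real) \<Rightarrow>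
    ('a \<times> real) measure \<Rightarrow> (nat \<Rightarrow> (nat \<Rightarrow> 'a \<times> real) \<Rightarrow> 'a \<Rightarrow> real) \<Rightarrow> bool" where
  "risk_consistent X L P fh \<longleftrightarrow>
     (\<forall>n\<ge>1. (\<lambda>z. risk L P (fh n z)) \<in> borel_measurable (\<Pi>\<^sub>M i\<in>{..<n}. P)) \<and>
     (\<forall>e>0. (\<lambda>n. measure (\<Pi>\<^sub>M i\<in>{..<n}. P)
         {z \<in> space (\<Pi>\<^sub>M i\<in>{..<n}. P).
            \<bar>enn2ereal (risk L P (fh n z)) - enn2ereal (bayes_risk X L P)\<bar> > ereal e}) \<longlonglongrightarrow> 0)"

lemma ereal_abs_infinity_diff: "\<bar>(\<infinity>::ereal) - \<infinity>\<bar> = \<infinity>"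
  by simp

end

theory Submission
  imports Defs
begin

text \<open>
  The estimator \<open>f\<^sub>D\<close> minimizes a strongly convex functional, so replacing one of the \<open>n\<close> sample points
  moves it by at most the sum of two local Lipschitz constants of the loss, times \<open>\<kappa> / (\<lambda> n)\<close>. Since sample
  and test points are exchangeable, this bounds the expected risk of \<open>f\<^sub>D\<close> by its expected empirical
  risk, which by minimality is at most the regularized risk of any fixed \<open>h \<in> H\<close>. As \<open>f\<^sub>D\<close> is
  bounded by \<open>B = O(\<lambda>\<^bsup>-1/2\<^esup>)\<close> with high probability and test points with \<open>\<bar>y\<bar> > B\<close> contribute only a tail
  of the \<open>p\<close>-th moment, the stability error is \<open>O(1 / (\<lambda>\<^bsup>p\<^esup> n))\<close>, which tends to \<open>0\<close> because \<open>p \<le> max (2 p) p\<^sup>2\<close>.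
  The risk is at least the Bayes risk, hence Markov's inequality turns this bound in expectation
  into convergence in probability.
\<close>

subsection \<open>Convex functions and Hilbert function spaces\<close>

text \<open>Labels are unbounded, so no Lipschitz constant of the loss serves all samples. The
  argument is therefore confined to the event that the zero function has empirical risk at most
  \<open>M\<close>. There the estimator is bounded by \<open>\<kappa> * sqrt (M / lam)\<close>, and
  the complement has probability at most \<open>c0 / M\<close>, with \<open>c0\<close> the risk of
  zero. \<open>M\<close> depends only on the target accuracy, not on \<open>n\<close>. The exchange
  of points also changes the sample in this event. Enlarging \<open>M\<close> to
  \<open>M + 1\<close> absorbs the change as long as one truncated loss, at most
  \<open>c * (B powr p + 1)\<close>, does not exceed \<open>n\<close>. The rate comes from squaring
  the Lipschitz constant of order \<open>B powr (p - 1)\<close>: with \<open>B\<close> of order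
  \<open>lam powr (- 1 / 2)\<close>, the square divided by \<open>lam * n\<close> is of order
  \<open>1 / (lam powr p * n)\<close>. Two further ingredients are needed. The estimator has no
  closed formula, so its measurability is derived from its continuity in the sample. The fixed
  competitor in \<open>H\<close> must have risk close to the Bayes risk; since the loss grows like a
  \<open>p\<close>-th power, uniform or almost sure approximation is combined with an integrable
  envelope at each stage.\<close>

lemma convex_on_lipschitz_bound:
  fixes l :: "real \<Rightarrow> real"
  assumes conv: "convex_on UNIV l" and nonneg: "\<And>r. 0 \<le> l r"
    and bound: "\<And>r. \<bar>r\<bar> \<le> 2 * a \<Longrightarrow> l r \<le> b" and a: "0 < a"
    and r: "\<bar>r\<bar> \<le> a" and s: "\<bar>s\<bar> \<le> a"
  shows "\<bar>l r - l s\<bar> \<le> b / a * \<bar>r - s\<bar>"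
proof -
  \<comment> \<open>Convexity makes chord slopes increase, so the slope over \<open>[r, s]\<close>
    is at most the one over \<open>[s, s + a]\<close>. That chord stays inside
    \<open>[-2a, 2a]\<close>, rises by at most \<open>b\<close> because \<open>l\<close> is
    nonnegative, and has length \<open>a\<close>. The lower bound uses the chord over
    \<open>[r - a, r]\<close> in the same way.\<close>
  have up: "l s - l r \<le> b / a * (s - r)" if "r < s" "\<bar>r\<bar> \<le> a" "\<bar>s\<bar> \<le> a" for r s
  proof -
    have "(l r - l s) / (r - s) \<le> (l r - l (s + a)) / (r - (s + a))"
      using convex_on_slope_le(1)[OF conv, of r "s + a" s] that a by simp
    also have "\<dots> \<le> (l s - l (s + a)) / (s - (s + a))"
      using convex_on_slope_le(2)[OF conv, of r "s + a" s] that a by simp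
    also have "\<dots> = (l (s + a) - l s) / a"
      by (simp add: minus_divide_left)
    also have "\<dots> \<le> b / a"
      using bound[of "s + a"] nonneg[of s] that a by (intro divide_right_mono) (simp_all add: abs_le_iff)
    finally have "(l s - l r) / (s - r) \<le> b / a"
      by (metis minus_diff_eq minus_divide_divide)
    then show ?thesis
      using that by (simp add: pos_divide_le_eq mult.commute)
  qed
  have down: "l r - l s \<le> b / a * (s - r)" if "r < s" "\<bar>r\<bar> \<le> a" "\<bar>s\<bar> \<le> a" for r s
  proof -
    have "(l (r - a) - l r) / ((r - a) - r) \<le> (l (r - a) - l s) / ((r - a) - s)"
      using convex_on_slope_le(1)[OF conv, of "r - a" s r] that a by simp
    also have "\<dots> \<le> (l r - l s) / (r - s)"
      using convex_on_slope_le(2)[OF conv, of "r - a" s r] that a by simp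
    finally have "(l (r - a) - l r) / ((r - a) - r) \<le> (l r - l s) / (r - s)" .
    moreover have "(l (r - a) - l r) / ((r - a) - r) = - ((l (r - a) - l r) / a)"
      by simp
    moreover have "(l (r - a) - l r) / a \<le> b / a"
      using bound[of "r - a"] nonneg[of r] that a by (intro divide_right_mono) (simp_all add: abs_le_iff)
    moreover have "(l r - l s) / (r - s) = (l s - l r) / (s - r)"
      by (metis minus_diff_eq minus_divide_divide)
    ultimately have "- (b / a) \<le> (l s - l r) / (s - r)"
      by linarith
    then show ?thesis
      using that pos_le_divide_eq[of "s - r" "- (b / a)" "l s - l r"] by simp
  qed
  show ?thesis
  proof (cases r s rule: linorder_cases)
    case less
    then show ?thesis
      using up[OF less r s] down[OF less r s] by (simp add: abs_le_iff abs_minus_commute[of r s])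
  next
    case greater
    then show ?thesis
      using up[OF greater s r] down[OF greater s r] by (simp add: abs_le_iff)
  qed simp
qed

lemma powr_sum_le:
  fixes a b p :: real
  assumes "0 \<le> a" "0 \<le> b" "0 \<le> p"
  shows "(a + b) powr p \<le> 2 powr p * (a powr p + b powr p)"
proof -
  have "(a + b) powr p \<le> (2 * max a b) powr p"
    using assms by (intro powr_mono2) auto
  also have "\<dots> = 2 powr p * max a b powr p"
    using assms by (simp add: powr_mult)
  also have "\<dots> \<le> 2 powr p * (a powr p + b powr p)"
    by (intro mult_left_mono) (auto simp: max_def)
  finally show ?thesis .
qed

section \<open>Inner product geometry: parallelogram identity, Cauchy-Schwarz and triangle
  inequality\<close>

context hilbert_function_space
begin

lemma diff_mem: "f \<in> H \<Longrightarrow> g \<in> H \<Longrightarrow> (\<lambda>x. f x - g x) \<in> H"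
  using add_mem[OF _ scale_mem[of g "-1"], of f] by simp

lemma mid_mem: "f \<in> H \<Longrightarrow> g \<in> H \<Longrightarrow> (\<lambda>x. (f x + g x) / 2) \<in> H"
  using scale_mem[OF add_mem, of f g "1/2"] by simp

lemma hnorm_nonneg: "f \<in> H \<Longrightarrow> 0 \<le> hnorm ip f"
  by (simp add: hnorm_def ip_nonneg)

lemma hnorm_power2: "f \<in> H \<Longrightarrow> (hnorm ip f)\<^sup>2 = ip f f"
  by (simp add: hnorm_def ip_nonneg)

lemma hnorm_zero: "hnorm ip (\<lambda>x. 0) = 0"
  using ip_scale[OF zero_mem zero_mem, of 0] by (simp add: hnorm_def)

lemma ip_lincomb_right:
  assumes "f \<in> H" "g \<in> H" "h \<in> H"
  shows "ip h (\<lambda>x. a * f x + b * g x) = a * ip h f + b * ip h g"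
  using assms by (simp add: ip_sym[of h] ip_add ip_scale scale_mem add_mem)

lemma hnorm_lincomb_power2:
  assumes "f \<in> H" "g \<in> H"
  shows "(hnorm ip (\<lambda>x. a * f x + b * g x))\<^sup>2 =
    a\<^sup>2 * (hnorm ip f)\<^sup>2 + 2 * a * b * ip f g + b\<^sup>2 * (hnorm ip g)\<^sup>2"
proof -
  have m: "(\<lambda>x. a * f x) \<in> H" "(\<lambda>x. b * g x) \<in> H" "(\<lambda>x. a * f x + b * g x) \<in> H"
    using assms by (auto intro: scale_mem add_mem)
  have "(hnorm ip (\<lambda>x. a * f x + b * g x))\<^sup>2
      = a * ip f (\<lambda>x. a * f x + b * g x) + b * ip g (\<lambda>x. a * f x + b * g x)"
    using assms m by (simp add: hnorm_power2 ip_add ip_scale)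
  also have "\<dots> = a * (a * ip f f + b * ip f g) + b * (a * ip g f + b * ip g g)"
    using assms by (simp only: ip_lincomb_right)
  also have "\<dots> = a\<^sup>2 * ip f f + 2 * a * b * ip f g + b\<^sup>2 * ip g g"
    using ip_sym[OF assms] by (simp add: power2_eq_square algebra_simps)
  finally show ?thesis
    using assms by (simp add: hnorm_power2)
qed

lemma hnorm_diff_power2:
  assumes "f \<in> H" "g \<in> H"
  shows "(hnorm ip (\<lambda>x. f x - g x))\<^sup>2 = (hnorm ip f)\<^sup>2 - 2 * ip f g + (hnorm ip g)\<^sup>2"
  using hnorm_lincomb_power2[OF assms, of 1 "-1"] by simp

text \<open>The parallelogram identity in midpoint form. The subtracted term is the only source of
  strong convexity; it drives existence, uniqueness, stability and continuity of the
  minimizer.\<close>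

lemma hnorm_mid_power2:
  assumes "f \<in> H" "g \<in> H"
  shows "(hnorm ip (\<lambda>x. (f x + g x) / 2))\<^sup>2
    = ((hnorm ip f)\<^sup>2 + (hnorm ip g)\<^sup>2) / 2 - (hnorm ip (\<lambda>x. f x - g x))\<^sup>2 / 4"
proof -
  have "(\<lambda>x. (f x + g x) / 2) = (\<lambda>x. 1/2 * f x + 1/2 * g x)"
    by (auto simp: field_simps)
  then show ?thesis
    by (simp only: hnorm_lincomb_power2[OF assms] hnorm_diff_power2[OF assms])
      (simp add: power2_eq_square field_simps)
qed

lemma Cauchy_Schwarz:
  assumes f: "f \<in> H" and g: "g \<in> H"
  shows "\<bar>ip f g\<bar> \<le> hnorm ip f * hnorm ip g"
proof -
  let ?a = "hnorm ip f" and ?b = "hnorm ip g"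
  have q: "0 \<le> a\<^sup>2 * ?a\<^sup>2 + 2 * a * b * ip f g + b\<^sup>2 * ?b\<^sup>2" for a b
    using hnorm_lincomb_power2[OF f g, of a b] by (metis zero_le_power2)
  show ?thesis
  proof (cases "?b = 0")
    case True
    then have "g = (\<lambda>x. 0)"
      using g ip_definite by (simp add: hnorm_def)
    then have "ip f g = 0"
      using f g ip_scale[of g f 0] ip_sym[of f g] by simp
    then show ?thesis
      using True by simp
  next
    case False
    then have b: "?b > 0"
      using hnorm_nonneg[OF g] by simp
    \<comment> \<open>The coefficients \<open>?b\<^sup>2\<close> and \<open>- ip f g\<close> give,
      up to a factor, the component of \<open>f\<close> orthogonal to \<open>g\<close>.\<close>
    have "0 \<le> (?b\<^sup>2)\<^sup>2 * ?a\<^sup>2 + 2 * ?b\<^sup>2 * (- ip f g) * ip f g + (- ip f g)\<^sup>2 * ?b\<^sup>2"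
      by (rule q)
    also have "\<dots> = ?b\<^sup>2 * ((?a * ?b)\<^sup>2 - (ip f g)\<^sup>2)"
      by (simp add: power2_eq_square algebra_simps)
    finally have "(ip f g)\<^sup>2 \<le> (?a * ?b)\<^sup>2"
      using b by (simp add: zero_le_mult_iff)
    then show ?thesis
      using hnorm_nonneg[OF f] hnorm_nonneg[OF g] abs_le_square_iff[of "ip f g" "?a * ?b"] by simp
  qed
qed

lemma hnorm_le_add:
  assumes f: "f \<in> H" and g: "g \<in> H"
  shows "hnorm ip f \<le> hnorm ip g + hnorm ip (\<lambda>x. f x - g x)"
proof -
  let ?d = "\<lambda>x. f x - g x"
  have d: "?d \<in> H"
    using f g by (rule diff_mem)
  have "(hnorm ip f)\<^sup>2 = (hnorm ip g)\<^sup>2 + 2 * ip g ?d + (hnorm ip ?d)\<^sup>2"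
    using hnorm_lincomb_power2[OF g d, of 1 1] by simp
  also have "\<dots> \<le> (hnorm ip g + hnorm ip ?d)\<^sup>2"
    using Cauchy_Schwarz[OF g d] by (simp add: power2_sum)
  finally show ?thesis
    by (rule power2_le_imp_le) (simp add: hnorm_nonneg d g)
qed

lemma hnorm_diff_commute:
  assumes f: "f \<in> H" and g: "g \<in> H"
  shows "hnorm ip (\<lambda>x. f x - g x) = hnorm ip (\<lambda>x. g x - f x)"
proof (rule power2_eq_imp_eq)
  show "(hnorm ip (\<lambda>x. f x - g x))\<^sup>2 = (hnorm ip (\<lambda>x. g x - f x))\<^sup>2"
    unfolding hnorm_diff_power2[OF f g] hnorm_diff_power2[OF g f] ip_sym[OF g f] by simp
qed (use f g in \<open>auto intro!: hnorm_nonneg diff_mem\<close>)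

lemma tendsto_hnorm:
  assumes F: "\<And>n. F n \<in> H" and f: "f \<in> H"
    and lim: "(\<lambda>n. hnorm ip (\<lambda>x. F n x - f x)) \<longlonglongrightarrow> 0"
  shows "(\<lambda>n. hnorm ip (F n)) \<longlonglongrightarrow> hnorm ip f"
proof -
  have sym: "hnorm ip (\<lambda>x. f x - F n x) = hnorm ip (\<lambda>x. F n x - f x)" for n
    by (rule hnorm_diff_commute[OF f F])
  have "\<bar>hnorm ip (F n) - hnorm ip f\<bar> \<le> hnorm ip (\<lambda>x. F n x - f x)" for n
    using hnorm_le_add[OF F f, of n] hnorm_le_add[OF f F, of n] sym[of n] by simp
  then show ?thesis
    by (intro Lim_null_comparison[OF always_eventually lim, THEN LIM_zero_cancel]) simp
qed

end

section \<open>Control of point evaluations through the kernel\<close>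

context rkhs
begin

lemma ip_kernel_section:
  "x \<in> X \<Longrightarrow> x' \<in> X \<Longrightarrow> ip (kernel_section X k x) (kernel_section X k x') = k x' x"
  using reproducing[OF section_mem, of x x'] by (simp add: kernel_section_def)

lemma abs_eval_le:
  assumes "f \<in> H" "x \<in> X"
  shows "\<bar>f x\<bar> \<le> hnorm ip f * sqrt (k x x)"
  using Cauchy_Schwarz[OF assms(1) section_mem[OF assms(2)]] assms
  by (simp add: reproducing[symmetric] hnorm_def[of _ "kernel_section X k x"] ip_kernel_section)

lemma kernel_diff_power2:
  assumes "x \<in> X" "x' \<in> X"
  shows "(hnorm ip (\<lambda>t. kernel_section X k x t - kernel_section X k x' t))\<^sup>2
    = k x x - 2 * k x x' + k x' x'"
  using kernel assms
  by (simp add: hnorm_diff_power2 section_mem hnorm_power2 ip_kernel_section kernel_on_def)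

lemma kernel_diff_nonneg:
  assumes "x \<in> X" "x' \<in> X"
  shows "0 \<le> k x x - 2 * k x x' + k x' x'"
  using kernel_diff_power2[OF assms] by (metis zero_le_power2)

text \<open>The square root is the distance between the two kernel sections in \<open>H\<close>. For
  a continuous kernel this makes every ball of \<open>H\<close> equicontinuous, which is needed when
  a function and its evaluation point vary together.\<close>

lemma abs_eval_diff_le:
  assumes f: "f \<in> H" and x: "x \<in> X" and x': "x' \<in> X"
  shows "\<bar>f x - f x'\<bar> \<le> hnorm ip f * sqrt (k x x - 2 * k x x' + k x' x')"
proof -
  let ?s = "kernel_section X k"
  let ?d = "\<lambda>t. ?s x t - ?s x' t"
  have d: "?d \<in> H"
    using x x' by (intro diff_mem section_mem)
  have "ip f ?d = f x - f x'"
    using ip_lincomb_right[OF section_mem[OF x] section_mem[OF x'] f, of 1 "-1"] f x x'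
    by (simp add: reproducing[symmetric])
  then show ?thesis
    using Cauchy_Schwarz[OF f d] hnorm_nonneg[OF d] kernel_diff_power2[OF x x']
    by (metis real_sqrt_unique)
qed

end

subsection \<open>The regularized empirical risk and its minimizer\<close>

locale svm_problem = rkhs X k H ip
  for X :: "'a::euclidean_space set"
    and k :: "'a \<Rightarrow> 'a \<Rightarrow> real"
    and H :: "('a \<Rightarrow> real) set"
    and ip :: "('a \<Rightarrow> real) \<Rightarrow> ('a \<Rightarrow> real) \<Rightarrow> real" +
  fixes Y :: "real set"
    and L :: "real \<Rightarrow> real \<Rightarrow> real"
    and l :: "real \<Rightarrow> real"
    and c p \<kappa> :: real
  assumes compact_X: "compact X"
    and closed_Y: "closed Y"
    and continuous_kernel: "continuous_on (X \<times> X) (\<lambda>(x, x'). k x x')"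
    and continuous_H: "\<And>f. f \<in> H \<Longrightarrow> continuous_on X f"
    and loss_eq: "\<And>y t. y \<in> Y \<Longrightarrow> L y t = l (y - t)"
    and convex_l: "convex_on UNIV l"
    and l_nonneg: "\<And>r. 0 \<le> l r"
    and l_zero: "l 0 = 0"
    and l_upper: "\<And>r. l r \<le> c * (\<bar>r\<bar> powr p + 1)"
    and c_pos: "0 < c"
    and p_ge_1: "1 \<le> p"
    and \<kappa>_ge_1: "1 \<le> \<kappa>"
    and kernel_bound: "\<And>x. x \<in> X \<Longrightarrow> sqrt (k x x) \<le> \<kappa>"
begin

text \<open>Coordinates from \<open>n\<close> on are left free, so that this is a closed subset of
  the full function space with its product topology; the measurability proof relies on that.\<close>

definition samples :: "nat \<Rightarrow> (nat \<Rightarrow> 'a \<times> real) set" where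
  "samples n = {z. \<forall>i<n. z i \<in> X \<times> Y}"

text \<open>For \<open>a \<ge> 1\<close>, the upper order bounds \<open>l\<close> on
  \<open>[-2a, 2a]\<close> by \<open>c * (2 powr p * a powr p + 1)\<close>, hence by
  \<open>lip * a powr p\<close>. Division by \<open>a\<close> turns this into the Lipschitz constant
  \<open>lip * a powr (p - 1)\<close> on \<open>[-a, a]\<close>.\<close>

definition lip :: real where
  "lip = c * (2 powr p + 1)"

lemma lip_pos: "0 < lip"
  unfolding lip_def using c_pos by (simp add: add_pos_pos)

lemma continuous_l: "continuous_on A l"
  using convex_on_continuous[OF open_UNIV convex_l] continuous_on_subset by blast

lemma l_measurable [measurable]: "l \<in> borel_measurable borel"
  by (intro borel_measurable_continuous_onI continuous_l)

lemma l_lipschitz: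
  assumes a: "1 \<le> a" and r: "\<bar>r\<bar> \<le> a" and s: "\<bar>s\<bar> \<le> a"
  shows "\<bar>l r - l s\<bar> \<le> lip * a powr (p - 1) * \<bar>r - s\<bar>"
proof -
  have b: "l r \<le> c * (2 powr p * a powr p + 1)" if "\<bar>r\<bar> \<le> 2 * a" for r
  proof -
    have "\<bar>r\<bar> powr p \<le> (2 * a) powr p"
      using that p_ge_1 by (intro powr_mono2) auto
    then show ?thesis
      using order_trans[OF l_upper[of r]] c_pos a by (simp add: powr_mult)
  qed
  have "\<bar>l r - l s\<bar> \<le> c * (2 powr p * a powr p + 1) / a * \<bar>r - s\<bar>"
    using a by (intro convex_on_lipschitz_bound[OF convex_l l_nonneg b _ r s]) auto
  also have "\<dots> \<le> lip * a powr (p - 1) * \<bar>r - s\<bar>"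
  proof (intro mult_right_mono)
    have "1 \<le> a powr p"
      using a p_ge_1 by (simp add: ge_one_powr_ge_zero)
    then have "c * (2 powr p * a powr p + 1) \<le> c * (2 powr p * a powr p + a powr p)"
      using c_pos by simp
    also have "\<dots> = lip * a powr p"
      by (simp add: lip_def algebra_simps)
    finally show "c * (2 powr p * a powr p + 1) / a \<le> lip * a powr (p - 1)"
      using a by (simp add: powr_diff divide_right_mono)
  qed simp
  finally show ?thesis .
qed

lemma abs_eval_le_kappa:
  assumes "f \<in> H" "x \<in> X"
  shows "\<bar>f x\<bar> \<le> \<kappa> * hnorm ip f"
proof -
  have "hnorm ip f * sqrt (k x x) \<le> hnorm ip f * \<kappa>"
    using assms by (intro mult_left_mono kernel_bound hnorm_nonneg)
  then show ?thesis
    using abs_eval_le[OF assms] by (simp add: mult.commute)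
qed

lemma samplesD: "z \<in> samples n \<Longrightarrow> i < n \<Longrightarrow> fst (z i) \<in> X \<and> snd (z i) \<in> Y"
  by (auto simp: samples_def mem_Times_iff)

lemma reg_emp_risk_eq:
  assumes "z \<in> samples n"
  shows "reg_emp_risk L ip lam n z f =
    1 / real n * (\<Sum>i<n. l (snd (z i) - f (fst (z i)))) + lam * (hnorm ip f)\<^sup>2"
  unfolding reg_emp_risk_def using samplesD[OF assms] by (simp add: loss_eq)

lemma reg_emp_risk_nonneg:
  assumes "z \<in> samples n" "0 \<le> lam"
  shows "0 \<le> reg_emp_risk L ip lam n z f"
  unfolding reg_emp_risk_eq[OF assms(1)] using assms by (auto intro!: add_nonneg_nonneg divide_nonneg_nonneg sum_nonneg l_nonneg)

lemma reg_emp_risk_ge: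
  assumes "z \<in> samples n"
  shows "lam * (hnorm ip f)\<^sup>2 \<le> reg_emp_risk L ip lam n z f"
  unfolding reg_emp_risk_eq[OF assms(1)] by (auto intro!: divide_nonneg_nonneg sum_nonneg l_nonneg)

text \<open>The loss part is merely convex; the gain comes entirely from the parallelogram identity
  for the regularizer.\<close>

lemma reg_emp_risk_mid:
  assumes z: "z \<in> samples n" and f: "f \<in> H" and g: "g \<in> H"
  shows "reg_emp_risk L ip lam n z (\<lambda>x. (f x + g x) / 2) \<le>
    (reg_emp_risk L ip lam n z f + reg_emp_risk L ip lam n z g) / 2
      - lam / 4 * (hnorm ip (\<lambda>x. f x - g x))\<^sup>2"
proof -
  have "l (y - (a + b) / 2) \<le> l (y - a) / 2 + l (y - b) / 2" for y a b
  proof -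
    have "l ((1 - 1/2) *\<^sub>R (y - a) + (1/2) *\<^sub>R (y - b)) \<le> (1 - 1/2) * l (y - a) + 1/2 * l (y - b)"
      by (rule convex_onD[OF convex_l]) auto
    moreover have "(1 - 1/2) *\<^sub>R (y - a) + (1/2) *\<^sub>R (y - b) = y - (a + b) / 2"
      by (simp add: field_simps)
    ultimately show ?thesis
      by simp
  qed
  then have "(\<Sum>i<n. l (snd (z i) - (f (fst (z i)) + g (fst (z i))) / 2))
      \<le> (\<Sum>i<n. l (snd (z i) - f (fst (z i))) / 2 + l (snd (z i) - g (fst (z i))) / 2)"
    by (intro sum_mono)
  also have "\<dots> = ((\<Sum>i<n. l (snd (z i) - f (fst (z i)))) + (\<Sum>i<n. l (snd (z i) - g (fst (z i))))) / 2"
    by (simp add: sum.distrib add_divide_distrib sum_divide_distrib)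
  finally have "1 / real n * (\<Sum>i<n. l (snd (z i) - (f (fst (z i)) + g (fst (z i))) / 2))
    \<le> 1 / real n * (((\<Sum>i<n. l (snd (z i) - f (fst (z i)))) + (\<Sum>i<n. l (snd (z i) - g (fst (z i))))) / 2)"
    by (intro mult_left_mono) auto
  moreover have "a * S + lam * ((F + G) / 2 - D / 4) \<le> (a * A + lam * F + (a * B + lam * G)) / 2 - lam / 4 * D"
    if "a * S \<le> a * ((A + B) / 2)" for a S A B F G D :: real
    using that by (simp add: field_simps)
  ultimately show ?thesis
    unfolding reg_emp_risk_eq[OF z] hnorm_mid_power2[OF f g] by blast
qed

text \<open>The minimizer cannot be beaten by its midpoint with \<open>g\<close>, and the strong
  convexity gain at this midpoint is what remains. Two such inequalities, for two samples, add up to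
  the factor \<open>lam\<close> in the stability bound.\<close>

lemma reg_minimizer_growth:
  assumes z: "z \<in> samples n" and f: "reg_minimizer L H ip lam n z f" and g: "g \<in> H"
  shows "lam / 2 * (hnorm ip (\<lambda>x. g x - f x))\<^sup>2
    \<le> reg_emp_risk L ip lam n z g - reg_emp_risk L ip lam n z f"
proof -
  have fH: "f \<in> H"
    using f by (simp add: reg_minimizer_def)
  have "reg_emp_risk L ip lam n z f \<le> reg_emp_risk L ip lam n z (\<lambda>x. (g x + f x) / 2)"
    using f mid_mem[OF g fH] by (simp add: reg_minimizer_def)
  then show ?thesis
    using reg_emp_risk_mid[OF z g fH, of lam] by argo
qed

lemma tendsto_reg_emp_risk:
  assumes z: "z \<in> samples n" and F: "\<And>m. F m \<in> H" and f: "f \<in> H"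
    and lim: "(\<lambda>m. hnorm ip (\<lambda>x. F m x - f x)) \<longlonglongrightarrow> 0"
  shows "(\<lambda>m. reg_emp_risk L ip lam n z (F m)) \<longlonglongrightarrow> reg_emp_risk L ip lam n z f"
proof -
  have "(\<lambda>m. F m x) \<longlonglongrightarrow> f x" if "x \<in> X" for x
  proof (rule LIM_zero_cancel, rule Lim_null_comparison)
    show "\<forall>\<^sub>F m in sequentially. norm (F m x - f x) \<le> \<kappa> * hnorm ip (\<lambda>x. F m x - f x)"
      using abs_eval_le_kappa[OF diff_mem[OF F f] that] by simp
    show "(\<lambda>m. \<kappa> * hnorm ip (\<lambda>x. F m x - f x)) \<longlonglongrightarrow> 0"
      using tendsto_mult_left[OF lim, of \<kappa>] by simp
  qed
  then show ?thesis
    unfolding reg_emp_risk_eq[OF z] using samplesD[OF z]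
    by (intro tendsto_intros tendsto_hnorm[OF F f lim]
        continuous_on_tendsto_compose[OF continuous_l[of UNIV]]) auto
qed

text \<open>By strong convexity every minimizing sequence is a Cauchy sequence.\<close>

lemma reg_minimizer_exists:
  assumes z: "z \<in> samples n" and lam: "0 < lam"
  shows "\<exists>f. reg_minimizer L H ip lam n z f"
proof -
  let ?J = "reg_emp_risk L ip lam n z"
  define m where "m = Inf (?J ` H)"
  have bdd: "bdd_below (?J ` H)"
    using reg_emp_risk_nonneg[OF z] lam by (intro bdd_belowI[of _ 0]) auto
  have m_le: "m \<le> ?J f" if "f \<in> H" for f
    unfolding m_def using that bdd by (intro cInf_lower) auto
  have "\<exists>f\<in>H. ?J f < m + 1 / real (Suc j)" for j
    using cInf_lessD[of "?J ` H" "m + 1 / real (Suc j)"] zero_mem unfolding m_def by auto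
  then obtain F where F: "\<And>j. F j \<in> H" "\<And>j. ?J (F j) < m + 1 / real (Suc j)"
    by metis
  have gap: "lam / 4 * (hnorm ip (\<lambda>x. F i x - F j x))\<^sup>2 \<le> 1 / real (Suc N)"
    if "N \<le> i" "N \<le> j" for i j N
  proof -
    have "1 / real (Suc i) \<le> 1 / real (Suc N)" "1 / real (Suc j) \<le> 1 / real (Suc N)"
      using that by (auto simp: frac_le)
    then show ?thesis
      using reg_emp_risk_mid[OF z F(1) F(1), of lam i j] m_le[OF mid_mem[OF F(1) F(1), of i j]]
        F(2)[of i] F(2)[of j] by argo
  qed
  have "\<forall>e>0. \<exists>N. \<forall>i\<ge>N. \<forall>j\<ge>N. hnorm ip (\<lambda>x. F i x - F j x) < e"
  proof (intro allI impI)
    fix e :: real assume e: "0 < e"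
    obtain N where N: "inverse (real (Suc N)) < lam / 4 * e\<^sup>2"
      using reals_Archimedean[of "lam / 4 * e\<^sup>2"] e lam by auto
    have "hnorm ip (\<lambda>x. F i x - F j x) < e" if "N \<le> i" "N \<le> j" for i j
    proof -
      have "lam / 4 * (hnorm ip (\<lambda>x. F i x - F j x))\<^sup>2 < lam / 4 * e\<^sup>2"
        using gap[OF that] N by (simp add: inverse_eq_divide)
      then have "(hnorm ip (\<lambda>x. F i x - F j x))\<^sup>2 < e\<^sup>2"
        using lam by simp
      then show ?thesis
        by (rule power2_less_imp_less) (use e in simp)
    qed
    then show "\<exists>N. \<forall>i\<ge>N. \<forall>j\<ge>N. hnorm ip (\<lambda>x. F i x - F j x) < e"
      by blast
  qed
  then obtain f where f: "f \<in> H" "(\<lambda>j. hnorm ip (\<lambda>x. F j x - f x)) \<longlonglongrightarrow> 0"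
    using complete[of F] F(1) by blast
  have "(\<lambda>j. m + 1 / real (Suc j)) \<longlonglongrightarrow> m + 0"
    by (intro tendsto_intros LIMSEQ_Suc[OF lim_1_over_n])
  then have "?J f \<le> m"
    using F(2) by (intro LIMSEQ_le[OF tendsto_reg_emp_risk[OF z F(1) f]]) (auto intro: less_imp_le)
  then show ?thesis
    unfolding reg_minimizer_def using f(1) m_le order_trans by blast
qed

lemma reg_minimizer_unique:
  assumes z: "z \<in> samples n" and lam: "0 < lam"
    and f: "reg_minimizer L H ip lam n z f" and g: "reg_minimizer L H ip lam n z g"
  shows "f = g"
proof -
  have m: "f \<in> H" "g \<in> H"
    using f g by (auto simp: reg_minimizer_def)
  have "lam / 2 * (hnorm ip (\<lambda>x. g x - f x))\<^sup>2 \<le> 0"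
    using reg_minimizer_growth[OF z f m(2)] g m by (force simp: reg_minimizer_def)
  then have "(hnorm ip (\<lambda>x. g x - f x))\<^sup>2 \<le> 0"
    using lam by (simp add: mult_le_0_iff)
  then have "(\<lambda>x. g x - f x) = (\<lambda>x. 0)"
    using m by (intro ip_definite) (auto simp: hnorm_def intro: diff_mem)
  then show ?thesis
    by (auto simp: fun_eq_iff)
qed

lemma reg_minimizer_ex1:
  assumes "z \<in> samples n" "0 < lam"
  shows "\<exists>!f. reg_minimizer L H ip lam n z f"
  using reg_minimizer_exists[OF assms] reg_minimizer_unique[OF assms] by blast

lemma svm_minimizer:
  assumes "z \<in> samples n" "0 < lam"
  shows "reg_minimizer L H ip lam n z (svm L H ip lam n z)"
  unfolding svm_def by (rule theI'[OF reg_minimizer_ex1[OF assms]])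

lemma svm_mem: "z \<in> samples n \<Longrightarrow> 0 < lam \<Longrightarrow> svm L H ip lam n z \<in> H"
  using svm_minimizer by (simp add: reg_minimizer_def)

lemma svm_le: "z \<in> samples n \<Longrightarrow> 0 < lam \<Longrightarrow> g \<in> H \<Longrightarrow>
    reg_emp_risk L ip lam n z (svm L H ip lam n z) \<le> reg_emp_risk L ip lam n z g"
  using svm_minimizer by (simp add: reg_minimizer_def)

text \<open>This is the regularized empirical risk of the zero function, which therefore dominates
  \<open>lam\<close> times the squared norm of the minimizer. Its mean is the risk of zero, so a
  bound on it holds with high probability.\<close>

definition zero_risk :: "nat \<Rightarrow> (nat \<Rightarrow> 'a \<times> real) \<Rightarrow> real" where
  "zero_risk n z = 1 / real n * (\<Sum>i<n. l (snd (z i)))"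

lemma svm_hnorm_le:
  assumes z: "z \<in> samples n" and lam: "0 < lam" and M: "zero_risk n z \<le> M"
  shows "hnorm ip (svm L H ip lam n z) \<le> sqrt (M / lam)"
proof -
  have "lam * (hnorm ip (svm L H ip lam n z))\<^sup>2 \<le> reg_emp_risk L ip lam n z (\<lambda>x. 0)"
    using reg_emp_risk_ge[OF z] svm_le[OF z lam zero_mem] order_trans by blast
  also have "\<dots> = zero_risk n z"
    by (simp add: reg_emp_risk_eq[OF z] hnorm_zero zero_risk_def)
  finally have "(hnorm ip (svm L H ip lam n z))\<^sup>2 \<le> M / lam"
    using lam M by (simp add: field_simps)
  then show ?thesis
    by (rule real_le_rsqrt)
qed

end

subsection \<open>Stability and continuity in the sample\<close>

context svm_problem
begin

lemma samples_upd: "z \<in> samples n \<Longrightarrow> w \<in> X \<times> Y \<Longrightarrow> z(i := w) \<in> samples n"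
  by (auto simp: samples_def)

text \<open>With \<open>A = lip * (2 * B) powr (p - 1)\<close>, the Lipschitz constant of
  \<open>l\<close> on \<open>[-2B, 2B]\<close>, this is \<open>\<kappa> * A\<close> (from the
  displacement in norm to the change of the loss) times \<open>\<kappa> * A / (lam * n)\<close> (the
  scale of the displacement).\<close>

definition stab_const :: "real \<Rightarrow> real \<Rightarrow> nat \<Rightarrow> real" where
  "stab_const B lam n = \<kappa>\<^sup>2 * (lip * (2 * B) powr (p - 1))\<^sup>2 / (lam * real n)"

text \<open>Adding the growth inequalities of both minimizers leaves only the summands of the
  exchanged points, since the two functionals differ nowhere else. Their Lipschitz bounds are linear
  in the distance \<open>\<delta>\<close> while the left side is quadratic, so one factor
  \<open>\<delta>\<close> cancels. The roles are asymmetric: \<open>z i\<close> becomes the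
  truncated test point and has a bounded label, whereas the label of \<open>w\<close> enters through
  a factor that is integrated later.\<close>

lemma svm_stability:
  fixes z :: "nat \<Rightarrow> 'a \<times> real" and w :: "'a \<times> real" and i n :: nat and lam B :: real
  defines "f \<equiv> svm L H ip lam n z" and "g \<equiv> svm L H ip lam n (z(i := w))"
  assumes z: "z \<in> samples n" and w: "w \<in> X \<times> Y" and i: "i < n" and lam: "0 < lam" and B: "1 \<le> B"
    and fB: "\<And>x. x \<in> X \<Longrightarrow> \<bar>f x\<bar> \<le> B" and gB: "\<And>x. x \<in> X \<Longrightarrow> \<bar>g x\<bar> \<le> B"
    and yB: "\<bar>snd (z i)\<bar> \<le> B"
  shows "l (snd (z i) - g (fst (z i))) \<le> l (snd (z i) - f (fst (z i)))
    + stab_const B lam n * (1 + (1 + \<bar>snd w\<bar>) powr p)"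
proof -
  let ?z' = "z(i := w)" and ?d = "\<lambda>x. f x - g x"
  define A where "A = lip * (2 * B) powr (p - 1)"
  define S where "S = (1 + \<bar>snd w\<bar>) powr p"
  define \<delta> where "\<delta> = hnorm ip ?d"
  have A: "0 < A"
    unfolding A_def using lip_pos B by simp
  have n: "0 < real n"
    using i by simp
  have z': "?z' \<in> samples n"
    using z w by (rule samples_upd)
  have f: "f \<in> H" and g: "g \<in> H"
    unfolding f_def g_def using z z' lam by (auto intro: svm_mem)
  have \<delta>: "0 \<le> \<delta>"
    unfolding \<delta>_def by (intro hnorm_nonneg diff_mem f g)
  have x: "fst (z i) \<in> X" "fst w \<in> X"
    using samplesD[OF z i] w by auto
  have d: "\<bar>f x - g x\<bar> \<le> \<kappa> * \<delta>" if "x \<in> X" for x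
    using abs_eval_le_kappa[OF diff_mem[OF f g] that] by (simp add: \<delta>_def)
  have li: "\<bar>l (snd (z i) - g (fst (z i))) - l (snd (z i) - f (fst (z i)))\<bar> \<le> A * (\<kappa> * \<delta>)"
  proof -
    have "\<bar>l (snd (z i) - g (fst (z i))) - l (snd (z i) - f (fst (z i)))\<bar>
        \<le> A * \<bar>(snd (z i) - g (fst (z i))) - (snd (z i) - f (fst (z i)))\<bar>"
      unfolding A_def using fB[OF x(1)] gB[OF x(1)] yB B by (intro l_lipschitz) auto
    also have "\<dots> \<le> A * (\<kappa> * \<delta>)"
      using d[OF x(1)] A by (intro mult_left_mono) auto
    finally show ?thesis .
  qed
  have lw: "\<bar>l (snd w - f (fst w)) - l (snd w - g (fst w))\<bar> \<le> A * S * (\<kappa> * \<delta>)"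
  proof -
    have "\<bar>l (snd w - f (fst w)) - l (snd w - g (fst w))\<bar>
        \<le> lip * (\<bar>snd w\<bar> + B) powr (p - 1) * \<bar>(snd w - f (fst w)) - (snd w - g (fst w))\<bar>"
      using fB[OF x(2)] gB[OF x(2)] B by (intro l_lipschitz) auto
    also have "\<dots> \<le> (A * S) * (\<kappa> * \<delta>)"
    proof (rule mult_mono)
      \<comment> \<open>A product in place of a sum separates \<open>B\<close> from the unbounded
        label. Raising the exponent of the label factor from \<open>p - 1\<close> to
        \<open>p\<close> then yields exactly \<open>S\<close>.\<close>
      have "\<bar>snd w\<bar> + B \<le> 2 * B * (1 + \<bar>snd w\<bar>)"
        using B mult_mono[of 1 B "\<bar>snd w\<bar>" "\<bar>snd w\<bar>"] by (simp add: algebra_simps)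
      then have "(\<bar>snd w\<bar> + B) powr (p - 1) \<le> (2 * B * (1 + \<bar>snd w\<bar>)) powr (p - 1)"
        using B p_ge_1 by (intro powr_mono2) auto
      also have "\<dots> = (2 * B) powr (p - 1) * (1 + \<bar>snd w\<bar>) powr (p - 1)"
        using B by (simp add: powr_mult)
      also have "\<dots> \<le> (2 * B) powr (p - 1) * S"
        unfolding S_def by (intro mult_left_mono powr_mono) auto
      finally show "lip * (\<bar>snd w\<bar> + B) powr (p - 1) \<le> A * S"
        unfolding A_def using lip_pos by (simp add: mult.assoc)
      show "\<bar>(snd w - f (fst w)) - (snd w - g (fst w))\<bar> \<le> \<kappa> * \<delta>"
        using d[OF x(2)] by simp
      show "0 \<le> A * S"
        using A by (simp add: S_def)
    qed simp
    finally show ?thesis .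
  qed
  have upd: "(\<Sum>j<n. l (snd (?z' j) - h (fst (?z' j)))) - (\<Sum>j<n. l (snd (z j) - h (fst (z j))))
      = l (snd w - h (fst w)) - l (snd (z i) - h (fst (z i)))" for h :: "'a \<Rightarrow> real"
    using i by (simp add: sum.remove[of "{..<n}" i])
  have diff: "reg_emp_risk L ip lam n ?z' h - reg_emp_risk L ip lam n z h
      = 1 / real n * (l (snd w - h (fst w)) - l (snd (z i) - h (fst (z i))))" for h
    unfolding reg_emp_risk_eq[OF z] reg_emp_risk_eq[OF z'] upd[symmetric] by (simp add: right_diff_distrib)
  have "lam * \<delta>\<^sup>2 \<le> (reg_emp_risk L ip lam n ?z' f - reg_emp_risk L ip lam n z f)
      - (reg_emp_risk L ip lam n ?z' g - reg_emp_risk L ip lam n z g)"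
    using reg_minimizer_growth[OF z svm_minimizer[OF z lam] g]
      reg_minimizer_growth[OF z' svm_minimizer[OF z' lam] f]
    unfolding f_def[symmetric] g_def[symmetric] \<delta>_def hnorm_diff_commute[OF g f] by argo
  also have "\<dots> = 1 / real n * ((l (snd (z i) - g (fst (z i))) - l (snd (z i) - f (fst (z i))))
      + (l (snd w - f (fst w)) - l (snd w - g (fst w))))"
    unfolding diff by (simp add: algebra_simps)
  also have "\<dots> \<le> 1 / real n * (A * (\<kappa> * \<delta>) + A * S * (\<kappa> * \<delta>))"
    using li lw by (intro mult_left_mono) auto
  finally have "lam * \<delta> * \<delta> \<le> 1 / real n * (A * \<kappa> * (1 + S)) * \<delta>"
    by (simp add: algebra_simps power2_eq_square)
  moreover have "0 \<le> 1 / real n * (A * \<kappa> * (1 + S))"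
    using A \<kappa>_ge_1 by (simp add: S_def)
  ultimately have "lam * \<delta> \<le> 1 / real n * (A * \<kappa> * (1 + S))"
  proof (cases "\<delta> = 0")
    case False
    then have "0 < \<delta>"
      using \<delta> by simp
    with mult_right_le_imp_le show ?thesis
      using \<open>lam * \<delta> * \<delta> \<le> _\<close> by blast
  qed simp
  then have "\<delta> \<le> A * \<kappa> * (1 + S) / (lam * real n)"
    using lam n by (simp add: field_simps)
  then have "A * (\<kappa> * \<delta>) \<le> A * (\<kappa> * (A * \<kappa> * (1 + S) / (lam * real n)))"
    using A \<kappa>_ge_1 by (intro mult_left_mono) auto
  also have "\<dots> = stab_const B lam n * (1 + S)"
    by (simp add: stab_const_def A_def power2_eq_square)
  finally show ?thesis
    using li unfolding S_def by linarith
qed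

lemma svm_cong:
  assumes "\<And>i. i < n \<Longrightarrow> z i = z' i"
  shows "svm L H ip lam n z = svm L H ip lam n z'"
  unfolding svm_def reg_minimizer_def reg_emp_risk_def using assms by simp

text \<open>Meant for two sequences that approach each other but may both oscillate: on a bounded
  interval \<open>l\<close> is Lipschitz, so closeness of the arguments passes to the
  values.\<close>

lemma tendsto_l_diff:
  assumes d: "(\<lambda>m. a m - b m) \<longlonglongrightarrow> 0" and a: "\<And>m::nat. \<bar>a m\<bar> \<le> Q" and b: "\<And>m. \<bar>b m\<bar> \<le> Q"
  shows "(\<lambda>m. l (a m) - l (b m)) \<longlonglongrightarrow> 0"
proof (rule Lim_null_comparison)
  show "\<forall>\<^sub>F m in sequentially. norm (l (a m) - l (b m)) \<le> lip * (max 1 Q) powr (p - 1) * \<bar>a m - b m\<bar>"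
    using l_lipschitz[of "max 1 Q" "a _" "b _"] a b by (auto simp: le_max_iff_disj)
  show "(\<lambda>m. lip * (max 1 Q) powr (p - 1) * \<bar>a m - b m\<bar>) \<longlonglongrightarrow> 0"
    using tendsto_mult_left[OF tendsto_rabs[OF d], of "lip * (max 1 Q) powr (p - 1)"] by simp
qed

text \<open>Growth at the limit functional bounds the squared distance by the excess
  \<open>?J z (F m) - ?J z ?f\<close>. Since \<open>F m\<close> minimizes \<open>?J (zm m)\<close>,
  this excess is at most the error of changing the functional at \<open>F m\<close> plus the same
  error at the fixed function \<open>?f\<close>.\<close>

lemma tendsto_svm:
  assumes zm: "\<And>m. zm m \<in> samples n" and z: "z \<in> samples n" and lam: "0 < lam"
    and lim: "\<And>i. i < n \<Longrightarrow> (\<lambda>m. zm m i) \<longlonglongrightarrow> z i"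
  shows "(\<lambda>m. hnorm ip (\<lambda>x. svm L H ip lam n (zm m) x - svm L H ip lam n z x)) \<longlonglongrightarrow> 0"
proof -
  let ?J = "reg_emp_risk L ip lam n" and ?f = "svm L H ip lam n z"
  define F where "F m = svm L H ip lam n (zm m)" for m
  have f: "?f \<in> H" and F: "F m \<in> H" for m
    using zm z lam by (auto simp: F_def intro: svm_mem)
  have limx: "(\<lambda>m. fst (zm m i)) \<longlonglongrightarrow> fst (z i)" and limy: "(\<lambda>m. snd (zm m i)) \<longlonglongrightarrow> snd (z i)"
    if "i < n" for i
    using lim[OF that] by (auto intro: tendsto_intros)
  have x: "fst (z i) \<in> X" "fst (zm m i) \<in> X" if "i < n" for i m
    using samplesD[OF z that] samplesD[OF zm that] by auto
  \<comment> \<open>A convergent sequence is bounded, which provides one radius \<open>R\<close> for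
    all estimators \<open>F m\<close>.\<close>
  have "(\<lambda>m. zero_risk n (zm m)) \<longlonglongrightarrow> zero_risk n z"
    unfolding zero_risk_def
    by (intro tendsto_intros continuous_on_tendsto_compose[OF continuous_l[of UNIV]] limy) auto
  then obtain M where M: "\<And>m. zero_risk n (zm m) \<le> M"
    by (metis convergentI convergent_imp_Bseq BseqE abs_le_D1 real_norm_def)
  define R where "R = sqrt (M / lam)"
  have FR: "hnorm ip (F m) \<le> R" for m
    unfolding F_def R_def by (rule svm_hnorm_le[OF zm lam M])
  have R: "0 \<le> R"
    using FR[of 0] hnorm_nonneg[OF F, of 0] by linarith
  have eval: "\<bar>F m x\<bar> \<le> \<kappa> * R" if "x \<in> X" for m x
    using abs_eval_le_kappa[OF F that, of m] FR[of m] \<kappa>_ge_1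
    by (meson mult_left_mono order_trans zero_le_one)
  \<comment> \<open>Here the function and the sample change simultaneously. Nothing is yet known
    about convergence of \<open>F m\<close>; equicontinuity of the ball of radius \<open>R\<close>
    replaces it.\<close>
  have first: "(\<lambda>m. ?J z (F m) - ?J (zm m) (F m)) \<longlonglongrightarrow> 0"
  proof -
    have "(\<lambda>m. l (snd (z i) - F m (fst (z i))) - l (snd (zm m i) - F m (fst (zm m i)))) \<longlonglongrightarrow> 0"
      if i: "i < n" for i
    proof -
      obtain K where K: "\<And>m. \<bar>snd (zm m i)\<bar> \<le> K"
        using limy[OF i] by (metis convergentI convergent_imp_Bseq BseqE real_norm_def)
      have "snd (zm m i) \<ge> - K" "snd (zm m i) \<le> K" for m
        using K[of m] by auto
      then have K': "\<bar>snd (z i)\<bar> \<le> K"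
        using LIMSEQ_le_const2[OF limy[OF i], of K] LIMSEQ_le_const[OF limy[OF i], of "-K"] by auto
      let ?q = "\<lambda>m. k (fst (z i)) (fst (z i)) - 2 * k (fst (z i)) (fst (zm m i))
          + k (fst (zm m i)) (fst (zm m i))"
      have "(\<lambda>m. k (fst (z i)) (fst (zm m i))) \<longlonglongrightarrow> k (fst (z i)) (fst (z i))"
        using continuous_on_tendsto_compose[OF continuous_kernel,
            of "\<lambda>m. (fst (z i), fst (zm m i))" "(fst (z i), fst (z i))" sequentially]
          x[OF i] tendsto_Pair[OF tendsto_const[of "fst (z i)"] limx[OF i]] by simp
      moreover have "(\<lambda>m. k (fst (zm m i)) (fst (zm m i))) \<longlonglongrightarrow> k (fst (z i)) (fst (z i))"
        using continuous_on_tendsto_compose[OF continuous_kernel,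
            of "\<lambda>m. (fst (zm m i), fst (zm m i))" "(fst (z i), fst (z i))" sequentially]
          x[OF i] tendsto_Pair[OF limx[OF i] limx[OF i]] by simp
      ultimately have "(\<lambda>m. \<bar>snd (z i) - snd (zm m i)\<bar> + R * sqrt (?q m))
          \<longlonglongrightarrow> \<bar>snd (z i) - snd (z i)\<bar> + R * sqrt (k (fst (z i)) (fst (z i)) - 2 * k (fst (z i)) (fst (z i))
          + k (fst (z i)) (fst (z i)))"
        by (intro tendsto_intros limy[OF i])
      then have q: "(\<lambda>m. \<bar>snd (z i) - snd (zm m i)\<bar> + R * sqrt (?q m)) \<longlonglongrightarrow> 0"
        by simp
      have "(\<lambda>m. (snd (z i) - F m (fst (z i))) - (snd (zm m i) - F m (fst (zm m i)))) \<longlonglongrightarrow> 0"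
      proof (rule Lim_null_comparison[OF always_eventually q], rule allI)
        fix m
        have "\<bar>F m (fst (z i)) - F m (fst (zm m i))\<bar> \<le> hnorm ip (F m) * sqrt (?q m)"
          using abs_eval_diff_le[OF F x[OF i]] .
        also have "\<dots> \<le> R * sqrt (?q m)"
        proof (intro mult_right_mono FR real_sqrt_ge_zero)
          show "0 \<le> ?q m"
            using kernel_diff_nonneg[OF x[OF i]] .
        qed
        finally show "norm ((snd (z i) - F m (fst (z i))) - (snd (zm m i) - F m (fst (zm m i))))
            \<le> \<bar>snd (z i) - snd (zm m i)\<bar> + R * sqrt (?q m)"
          unfolding real_norm_def by arith
      qed
      moreover have "\<bar>snd (z i) - F m (fst (z i))\<bar> \<le> K + \<kappa> * R"
        and "\<bar>snd (zm m i) - F m (fst (zm m i))\<bar> \<le> K + \<kappa> * R" for m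
        using K[of m] K' eval[OF x(1)[OF i], of m] eval[OF x(2)[OF i], of m m] by arith+
      ultimately show ?thesis
        by (rule tendsto_l_diff)
    qed
    then have "(\<lambda>m. 1 / real n * (\<Sum>i<n. l (snd (z i) - F m (fst (z i))) - l (snd (zm m i) - F m (fst (zm m i)))))
        \<longlonglongrightarrow> 1 / real n * (\<Sum>i<n. 0)"
      by (intro tendsto_intros) auto
    then show ?thesis
      unfolding reg_emp_risk_eq[OF z] reg_emp_risk_eq[OF zm]
      by (simp add: sum_subtractf diff_divide_distrib)
  qed
  have second: "(\<lambda>m. ?J (zm m) ?f - ?J z ?f) \<longlonglongrightarrow> 0"
  proof (rule LIM_zero)
    have "(\<lambda>m. ?f (fst (zm m i))) \<longlonglongrightarrow> ?f (fst (z i))" if "i < n" for i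
      using x[OF that] by (intro continuous_on_tendsto_compose[OF continuous_H[OF f] limx[OF that]]) auto
    then show "(\<lambda>m. ?J (zm m) ?f) \<longlonglongrightarrow> ?J z ?f"
      unfolding reg_emp_risk_eq[OF z] reg_emp_risk_eq[OF zm]
      by (intro tendsto_intros continuous_on_tendsto_compose[OF continuous_l[of UNIV]] limy) auto
  qed
  have bound: "(hnorm ip (\<lambda>x. F m x - ?f x))\<^sup>2
      \<le> 2 / lam * ((?J z (F m) - ?J (zm m) (F m)) + (?J (zm m) ?f - ?J z ?f))" for m
  proof -
    have "?J (zm m) (F m) \<le> ?J (zm m) ?f"
      unfolding F_def by (rule svm_le[OF zm lam f])
    then have "lam / 2 * (hnorm ip (\<lambda>x. F m x - ?f x))\<^sup>2
        \<le> (?J z (F m) - ?J (zm m) (F m)) + (?J (zm m) ?f - ?J z ?f)"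
      using reg_minimizer_growth[OF z svm_minimizer[OF z lam] F, of m] by linarith
    then show ?thesis
      using lam by (simp add: field_simps)
  qed
  have "(\<lambda>m. 2 / lam * ((?J z (F m) - ?J (zm m) (F m)) + (?J (zm m) ?f - ?J z ?f))) \<longlonglongrightarrow> 2 / lam * (0 + 0)"
    by (intro tendsto_intros first second)
  then have lim0: "(\<lambda>m. 2 / lam * ((?J z (F m) - ?J (zm m) (F m)) + (?J (zm m) ?f - ?J z ?f))) \<longlonglongrightarrow> 0"
    by simp
  have "(\<lambda>m. (hnorm ip (\<lambda>x. F m x - ?f x))\<^sup>2) \<longlonglongrightarrow> 0"
    by (rule Lim_null_comparison[OF always_eventually lim0]) (use bound in simp)
  then have "(\<lambda>m. sqrt ((hnorm ip (\<lambda>x. F m x - ?f x))\<^sup>2)) \<longlonglongrightarrow> sqrt 0"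
    by (rule tendsto_real_sqrt)
  then show ?thesis
    unfolding F_def[symmetric] by (simp add: hnorm_nonneg diff_mem F f)
qed

end

subsection \<open>Exchanging sample and test points\<close>

text \<open>Coordinate \<open>i\<close> and the additional point are independent with the same law
  \<open>P\<close>. Splitting off coordinate \<open>i\<close> leaves a double integral over
  \<open>P\<close>, in which Fubini interchanges the two variables.\<close>

lemma nn_integral_PiM_swap:
  fixes \<Phi> :: "('i \<Rightarrow> 'b) \<times> 'b \<Rightarrow> ennreal"
  assumes "prob_space P" and I: "finite I" "i \<in> I"
    and \<Phi> [measurable]: "\<Phi> \<in> borel_measurable ((\<Pi>\<^sub>M i\<in>I. P) \<Otimes>\<^sub>M P)"
  shows "(\<integral>\<^sup>+ z. (\<integral>\<^sup>+ w. \<Phi> (z, w) \<partial>P) \<partial>(\<Pi>\<^sub>M i\<in>I. P))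
    = (\<integral>\<^sup>+ z. (\<integral>\<^sup>+ w. \<Phi> (z(i := w), z i) \<partial>P) \<partial>(\<Pi>\<^sub>M i\<in>I. P))"
proof -
  interpret prob_space P by fact
  interpret prod: product_sigma_finite "\<lambda>_. P" by standard
  interpret PP: pair_sigma_finite P P by standard
  let ?J = "I - {i}"
  have ins: "insert i ?J = I" and J: "finite ?J" "i \<notin> ?J"
    using I by auto
  have split: "(\<integral>\<^sup>+ z. F z \<partial>(\<Pi>\<^sub>M i\<in>I. P)) = (\<integral>\<^sup>+ x. (\<integral>\<^sup>+ y. F (x(i := y)) \<partial>P) \<partial>(\<Pi>\<^sub>M i\<in>?J. P))"
    if "F \<in> borel_measurable (\<Pi>\<^sub>M i\<in>I. P)" for F
    using prod.product_nn_integral_insert[OF J, of F] that unfolding ins by simp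
  have upd [measurable]: "(\<lambda>(z, w). (z(i := w), z i)) \<in> (\<Pi>\<^sub>M i\<in>I. P) \<Otimes>\<^sub>M P \<rightarrow>\<^sub>M (\<Pi>\<^sub>M i\<in>I. P) \<Otimes>\<^sub>M P"
    unfolding case_prod_beta
    by (rule measurable_Pair)
      (use I in \<open>auto intro!: measurable_fun_upd[where J = I] measurable_compose[OF measurable_fst]\<close>)
  have "(\<integral>\<^sup>+ z. (\<integral>\<^sup>+ w. \<Phi> (z, w) \<partial>P) \<partial>(\<Pi>\<^sub>M i\<in>I. P))
      = (\<integral>\<^sup>+ x. (\<integral>\<^sup>+ y. (\<integral>\<^sup>+ w. \<Phi> (x(i := y), w) \<partial>P) \<partial>P) \<partial>(\<Pi>\<^sub>M i\<in>?J. P))"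
    by (rule split) simp
  also have "\<dots> = (\<integral>\<^sup>+ x. (\<integral>\<^sup>+ y. (\<integral>\<^sup>+ w. \<Phi> (x(i := w), y) \<partial>P) \<partial>P) \<partial>(\<Pi>\<^sub>M i\<in>?J. P))"
  proof (rule nn_integral_cong)
    fix x assume x: "x \<in> space (\<Pi>\<^sub>M i\<in>?J. P)"
    have "(\<lambda>y. x(i := y)) \<in> P \<rightarrow>\<^sub>M (\<Pi>\<^sub>M i\<in>I. P)"
      using measurable_component_update[OF x, of i] J(2) unfolding ins by simp
    then have [measurable]: "(\<lambda>(y, w). \<Phi> (x(i := y), w)) \<in> borel_measurable (P \<Otimes>\<^sub>M P)"
      by measurable
    show "(\<integral>\<^sup>+ y. (\<integral>\<^sup>+ w. \<Phi> (x(i := y), w) \<partial>P) \<partial>P) = (\<integral>\<^sup>+ y. (\<integral>\<^sup>+ w. \<Phi> (x(i := w), y) \<partial>P) \<partial>P)"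
      using PP.Fubini'[of "\<lambda>y w. \<Phi> (x(i := y), w)"] by simp
  qed
  also have "\<dots> = (\<integral>\<^sup>+ x. (\<integral>\<^sup>+ y. (\<integral>\<^sup>+ w. \<Phi> ((x(i := y))(i := w), (x(i := y)) i) \<partial>P) \<partial>P) \<partial>(\<Pi>\<^sub>M i\<in>?J. P))"
    by simp
  also have "\<dots> = (\<integral>\<^sup>+ z. (\<integral>\<^sup>+ w. \<Phi> (z(i := w), z i) \<partial>P) \<partial>(\<Pi>\<^sub>M i\<in>I. P))"
  proof (rule split[symmetric])
    have "(\<lambda>(z, w). \<Phi> (z(i := w), z i)) = (\<lambda>q. \<Phi> ((\<lambda>(z, w). (z(i := w), z i)) q))"
      by auto
    then have "(\<lambda>(z, w). \<Phi> (z(i := w), z i)) \<in> borel_measurable ((\<Pi>\<^sub>M i\<in>I. P) \<Otimes>\<^sub>M P)"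
      using measurable_compose[OF upd \<Phi>] by (simp only:)
    then show "(\<lambda>z. \<integral>\<^sup>+ w. \<Phi> (z(i := w), z i) \<partial>P) \<in> borel_measurable (\<Pi>\<^sub>M i\<in>I. P)"
      by (rule borel_measurable_nn_integral)
  qed
  finally show ?thesis .
qed

locale svm_sampling = svm_problem X k H ip Y L l c p \<kappa>
  for X :: "'a::euclidean_space set"
    and k :: "'a \<Rightarrow> 'a \<Rightarrow> real"
    and H :: "('a \<Rightarrow> real) set"
    and ip :: "('a \<Rightarrow> real) \<Rightarrow> ('a \<Rightarrow> real) \<Rightarrow> real"
    and Y :: "real set"
    and L :: "real \<Rightarrow> real \<Rightarrow> real"
    and l :: "real \<Rightarrow> real"
    and c p \<kappa> :: real +
  fixes P :: "('a \<times> real) measure"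
  assumes distribution: "distribution_on X Y P"
    and moment_finite: "moment p P < \<infinity>"
begin

sublocale P: prob_space P
  using distribution by (simp add: distribution_on_def)

abbreviation sample_law :: "nat \<Rightarrow> (nat \<Rightarrow> 'a \<times> real) measure" where
  "sample_law n \<equiv> (\<Pi>\<^sub>M i\<in>{..<n}. P)"

lemma prob_space_sample_law: "prob_space (sample_law n)"
  by (intro prob_space_PiM P.prob_space_axioms)

lemma space_P: "space P = X \<times> Y"
  using distribution by (simp add: distribution_on_def)

section \<open>Measurability of the coordinates and of the estimator\<close>

lemma id_measurable: "(\<lambda>w. w) \<in> P \<rightarrow>\<^sub>M borel"
proof -
  have "sets P = sets (restrict_space borel (X \<times> Y))"
    using distribution by (simp add: distribution_on_def)
  then have "measurable P (borel :: ('a \<times> real) measure) = measurable (restrict_space borel (X \<times> Y)) borel"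
    by (rule measurable_cong_sets) simp
  then show ?thesis
    using measurable_restrict_space1[OF measurable_ident] by (simp add: id_def)
qed

lemma fst_measurable [measurable]: "fst \<in> P \<rightarrow>\<^sub>M borel"
  by (rule measurable_compose[OF id_measurable])
    (intro borel_measurable_continuous_onI continuous_intros)

lemma snd_measurable [measurable]: "snd \<in> P \<rightarrow>\<^sub>M borel"
  by (rule measurable_compose[OF id_measurable])
    (intro borel_measurable_continuous_onI continuous_intros)

lemma space_sample_law: "z \<in> space (sample_law n) \<Longrightarrow> z \<in> samples n"
  by (auto simp: space_PiM samples_def space_P)

text \<open>On the closed set \<open>C\<close> the map from a sample and a point to the prediction
  is continuous: convergence in \<open>H\<close> is uniform on \<open>X\<close>, and the limit
  function is continuous. Extended by zero it is Borel, and composing it with \<open>T\<close>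
  returns to the product space of samples.\<close>

lemma svm_measurable:
  assumes lam: "0 < lam"
  shows "(\<lambda>(z, w). svm L H ip lam n z (fst w)) \<in> borel_measurable (sample_law n \<Otimes>\<^sub>M P)"
proof -
  define C where "C = samples n \<times> X"
  \<comment> \<open>Coordinates from \<open>n\<close> on are not components of the sample law. The
    constant \<open>(0, 0)\<close> makes them trivially measurable, and by \<open>svm_cong\<close>
    it does not affect the estimator.\<close>
  define T :: "(nat \<Rightarrow> 'a \<times> real) \<times> ('a \<times> real) \<Rightarrow> (nat \<Rightarrow> 'a \<times> real) \<times> 'a"
    where "T = (\<lambda>(z, w). (\<lambda>i. if i < n then z i else (0, 0), fst w))"
  let ?G = "\<lambda>(z, x). svm L H ip lam n z x"
  have "closed (samples n)"
  proof -
    have "closed {z :: nat \<Rightarrow> 'a \<times> real. i < n \<longrightarrow> z i \<in> X \<times> Y}" for i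
    proof (cases "i < n")
      case True
      have "closed ((\<lambda>z :: nat \<Rightarrow> 'a \<times> real. z i) -` (X \<times> Y))"
        using continuous_closed_vimage[OF closed_Times[OF compact_imp_closed[OF compact_X] closed_Y]]
          continuous_on_product_coordinates[of i] continuous_on_eq_continuous_at[OF open_UNIV] by blast
      then show ?thesis
        using True by (simp add: vimage_def)
    qed simp
    then show ?thesis
      unfolding samples_def by (rule closed_Collect_all)
  qed
  then have C: "closed C"
    unfolding C_def by (intro closed_Times compact_imp_closed[OF compact_X])
  have cont: "continuous_on C ?G"
  proof (rule continuous_on_sequentiallyI)
    fix u a assume u: "\<forall>m. u m \<in> C" and a: "a \<in> C" and lim: "u \<longlonglongrightarrow> a"
    have z: "fst (u m) \<in> samples n" "fst a \<in> samples n" "snd (u m) \<in> X" "snd a \<in> X" for m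
      using u a by (auto simp: C_def mem_Times_iff)
    have limz: "(\<lambda>m. fst (u m) i) \<longlonglongrightarrow> fst a i" for i
      using continuous_on_tendsto_compose[OF continuous_on_product_coordinates[of i] tendsto_fst[OF lim]] by simp
    let ?f = "\<lambda>z. svm L H ip lam n z"
    have f: "?f (fst a) \<in> H" "?f (fst (u m)) \<in> H" for m
      using z lam by (auto intro: svm_mem)
    have "(\<lambda>m. \<kappa> * hnorm ip (\<lambda>x. ?f (fst (u m)) x - ?f (fst a) x)) \<longlonglongrightarrow> \<kappa> * 0"
      by (intro tendsto_intros tendsto_svm z lam limz)
    then have lim0: "(\<lambda>m. \<kappa> * hnorm ip (\<lambda>x. ?f (fst (u m)) x - ?f (fst a) x)) \<longlonglongrightarrow> 0"
      by simp
    have "(\<lambda>m. ?f (fst (u m)) (snd (u m)) - ?f (fst a) (snd (u m))) \<longlonglongrightarrow> 0"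
      by (rule Lim_null_comparison[OF always_eventually lim0])
        (use abs_eval_le_kappa[OF diff_mem[OF f(2) f(1)] z(3)] in simp)
    moreover have "(\<lambda>m. ?f (fst a) (snd (u m))) \<longlonglongrightarrow> ?f (fst a) (snd a)"
      using z by (intro continuous_on_tendsto_compose[OF continuous_H[OF f(1)] tendsto_snd[OF lim]]) auto
    ultimately have "(\<lambda>m. (?f (fst (u m)) (snd (u m)) - ?f (fst a) (snd (u m))) + ?f (fst a) (snd (u m)))
        \<longlonglongrightarrow> 0 + ?f (fst a) (snd a)"
      by (rule tendsto_add)
    then show "(\<lambda>m. ?G (u m)) \<longlonglongrightarrow> ?G a"
      by (simp add: case_prod_beta)
  qed
  have "(\<lambda>q. indicator C q *\<^sub>R ?G q) \<in> borel_measurable borel"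
    by (intro borel_measurable_continuous_on_indicator cont borel_closed C)
  moreover have "T \<in> sample_law n \<Otimes>\<^sub>M P \<rightarrow>\<^sub>M borel"
  proof -
    have "(\<lambda>q i. if i < n then fst q i else (0, 0)) \<in> sample_law n \<Otimes>\<^sub>M P \<rightarrow>\<^sub>M (\<Pi>\<^sub>M i\<in>UNIV. borel)"
    proof (rule measurable_PiM_single')
      fix i :: nat
      show "(\<lambda>q. if i < n then fst q i else (0, 0)) \<in> sample_law n \<Otimes>\<^sub>M P \<rightarrow>\<^sub>M borel"
        by (cases "i < n") (auto intro!: measurable_compose[OF _ id_measurable]
            measurable_compose[OF measurable_fst measurable_component_singleton])
    qed auto
    then have "(\<lambda>q i. if i < n then fst q i else (0, 0)) \<in> sample_law n \<Otimes>\<^sub>M P \<rightarrow>\<^sub>M borel"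
      by (subst measurable_cong_sets[OF refl sets_PiM_equal_borel[symmetric]])
    then have "T \<in> sample_law n \<Otimes>\<^sub>M P \<rightarrow>\<^sub>M borel \<Otimes>\<^sub>M borel"
      unfolding T_def case_prod_beta by (intro measurable_Pair) auto
    then show ?thesis
      by (simp add: borel_prod)
  qed
  ultimately have "(\<lambda>q. indicator C (T q) *\<^sub>R ?G (T q)) \<in> borel_measurable (sample_law n \<Otimes>\<^sub>M P)"
    by (rule measurable_compose[rotated])
  then show ?thesis
  proof (rule measurable_cong[THEN iffD1, rotated])
    fix q assume "q \<in> space (sample_law n \<Otimes>\<^sub>M P)"
    then have q: "fst q \<in> samples n" "fst (snd q) \<in> X"
      by (auto simp: space_pair_measure space_P dest: space_sample_law)
    then have "(\<lambda>i. if i < n then fst q i else (0, 0)) \<in> samples n"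
      by (simp add: samples_def)
    moreover have "svm L H ip lam n (\<lambda>i. if i < n then fst q i else (0, 0)) = svm L H ip lam n (fst q)"
      by (rule svm_cong) simp
    ultimately show "indicator C (T q) *\<^sub>R ?G (T q) = (\<lambda>(z, w). svm L H ip lam n z (fst w)) q"
      using q by (simp add: T_def C_def case_prod_beta)
  qed
qed

end

subsection \<open>The expected risk of the estimator\<close>

lemma nn_integral_cmult_sum:
  assumes "\<And>i. i \<in> I \<Longrightarrow> G i \<in> borel_measurable M"
  shows "(\<integral>\<^sup>+ z. a * (\<Sum>i\<in>I. G i z) \<partial>M) = a * (\<Sum>i\<in>I. \<integral>\<^sup>+ z. G i z \<partial>M)"
proof -
  have "(\<integral>\<^sup>+ z. a * (\<Sum>i\<in>I. G i z) \<partial>M) = a * (\<integral>\<^sup>+ z. (\<Sum>i\<in>I. G i z) \<partial>M)"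
    by (intro nn_integral_cmult borel_measurable_sum assms)
  then show ?thesis
    using nn_integral_sum[of I G M] assms by simp
qed

context svm_sampling
begin

lemma fst_measurable_X: "fst \<in> P \<rightarrow>\<^sub>M restrict_space borel X"
  by (rule measurable_restrict_space2) (auto simp: space_P)

lemma measurable_fst_compose:
  "f \<in> borel_measurable (restrict_space borel X) \<Longrightarrow> (\<lambda>w. f (fst w)) \<in> borel_measurable P"
  by (rule measurable_compose[OF fst_measurable_X])

lemma H_measurable: "f \<in> H \<Longrightarrow> f \<in> borel_measurable (restrict_space borel X)"
  by (intro borel_measurable_continuous_on_restrict continuous_H)

lemma risk_eq: "risk L P f = (\<integral>\<^sup>+ w. ennreal (l (snd w - f (fst w))) \<partial>P)"
  unfolding risk_def by (rule nn_integral_cong) (auto simp: space_P loss_eq)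

lemma nn_integral_sample_component:
  assumes i: "i < n" and h: "h \<in> borel_measurable P"
  shows "(\<integral>\<^sup>+ z. h (z i) \<partial>sample_law n) = (\<integral>\<^sup>+ w. h w \<partial>P)"
proof -
  have "(\<integral>\<^sup>+ w. h w \<partial>P) = (\<integral>\<^sup>+ w. h w \<partial>distr (sample_law n) P (\<lambda>z. z i))"
    by (subst distr_PiM_component) (use i P.prob_space_axioms in auto)
  also have "\<dots> = (\<integral>\<^sup>+ z. h (z i) \<partial>sample_law n)"
    using i h by (intro nn_integral_distr measurable_component_singleton) auto
  finally show ?thesis ..
qed

lemma nn_integral_average:
  assumes n: "1 \<le> n" and h: "h \<in> borel_measurable P" and nonneg: "\<And>w. 0 \<le> h w"
  shows "(\<integral>\<^sup>+ z. ennreal (1 / real n * (\<Sum>i<n. h (z i))) \<partial>sample_law n) = (\<integral>\<^sup>+ w. ennreal (h w) \<partial>P)"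
proof -
  have hi: "(\<lambda>z. ennreal (h (z i))) \<in> borel_measurable (sample_law n)" if "i < n" for i
    using that by (intro measurable_compose[OF _ measurable_ennreal] measurable_compose[OF _ h]
        measurable_component_singleton) auto
  have "(\<integral>\<^sup>+ z. ennreal (1 / real n * (\<Sum>i<n. h (z i))) \<partial>sample_law n)
      = (\<integral>\<^sup>+ z. ennreal (1 / real n) * (\<Sum>i<n. ennreal (h (z i))) \<partial>sample_law n)"
    using nonneg by (subst sum_ennreal) (auto simp: ennreal_mult[symmetric] sum_nonneg)
  also have "\<dots> = ennreal (1 / real n) * (\<Sum>i<n. \<integral>\<^sup>+ z. ennreal (h (z i)) \<partial>sample_law n)"
    using hi by (intro nn_integral_cmult_sum) auto
  also have "\<dots> = ennreal (1 / real n) * (\<Sum>i<n. \<integral>\<^sup>+ w. ennreal (h w) \<partial>P)"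
    using h by (intro arg_cong2[where f = "(*)"] sum.cong nn_integral_sample_component) auto
  also have "\<dots> = (ennreal (1 / real n) * ennreal (real n)) * (\<integral>\<^sup>+ w. ennreal (h w) \<partial>P)"
    by (simp add: ennreal_of_nat_eq_real_of_nat mult.assoc)
  also have "ennreal (1 / real n) * ennreal (real n) = 1"
    using n by (simp flip: ennreal_mult)
  finally show ?thesis
    by simp
qed

lemma nn_integral_emp_risk:
  assumes "1 \<le> n" and "f \<in> borel_measurable (restrict_space borel X)"
  shows "(\<integral>\<^sup>+ z. ennreal (1 / real n * (\<Sum>i<n. l (snd (z i) - f (fst (z i))))) \<partial>sample_law n) = risk L P f"
  unfolding risk_eq using measurable_fst_compose[OF assms(2)]
  by (intro nn_integral_average[OF assms(1), of "\<lambda>w. l (snd w - f (fst w))"]) (auto simp: l_nonneg)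

lemma zero_risk_measurable [measurable]: "zero_risk n \<in> borel_measurable (sample_law n)"
proof -
  have "(\<lambda>z. l (snd (z i))) \<in> borel_measurable (sample_law n)" if "i \<in> {..<n}" for i
    using that by (intro measurable_compose[OF _ l_measurable] measurable_compose[OF _ snd_measurable]
        measurable_component_singleton)
  then show ?thesis
    unfolding zero_risk_def by (intro borel_measurable_times borel_measurable_sum) auto
qed

section \<open>Integrable envelopes and tails\<close>

lemma nn_integral_moment_finite:
  assumes "0 \<le> a" "0 \<le> b"
  shows "(\<integral>\<^sup>+ w. ennreal ((a + b * \<bar>snd w\<bar>) powr p) \<partial>P) < \<infinity>"
proof -
  have le: "(a + b * \<bar>y\<bar>) powr p \<le> 2 powr p * a powr p + 2 powr p * b powr p * \<bar>y\<bar> powr p" for y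
    using powr_sum_le[of a "b * \<bar>y\<bar>" p] assms p_ge_1 by (simp add: powr_mult algebra_simps)
  have "(\<integral>\<^sup>+ w. ennreal ((a + b * \<bar>snd w\<bar>) powr p) \<partial>P)
      \<le> (\<integral>\<^sup>+ w. ennreal (2 powr p * a powr p) + ennreal (2 powr p * b powr p) * ennreal (\<bar>snd w\<bar> powr p) \<partial>P)"
    by (intro nn_integral_mono) (simp add: le ennreal_leI flip: ennreal_mult ennreal_plus)
  also have "\<dots> = ennreal (2 powr p * a powr p) + ennreal (2 powr p * b powr p) * moment p P"
    unfolding moment_def by (simp add: nn_integral_add nn_integral_cmult P.emeasure_space_1)
  also have "\<dots> < \<infinity>"
    using moment_finite by (auto simp: ennreal_mult_less_top)
  finally show ?thesis .
qed

text \<open>The mean of the factor that the replacing point contributes in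
  \<open>svm_stability\<close>.\<close>

definition shifted_moment :: ennreal where
  "shifted_moment = (\<integral>\<^sup>+ w. ennreal ((1 + \<bar>snd w\<bar>) powr p) \<partial>P)"

lemma shifted_moment_finite: "shifted_moment < \<infinity>"
  using nn_integral_moment_finite[of 1 1] by (simp add: shifted_moment_def)

text \<open>The integrand dominates the loss whenever the prediction is bounded by \<open>b\<close>
  or by \<open>\<bar>y\<bar>\<close>, since the residual is then at most
  \<open>b + 2 * \<bar>y\<bar>\<close>. It serves the tail estimate and the dominated convergence
  arguments for the Bayes risk.\<close>

lemma envelope_finite: "0 \<le> b \<Longrightarrow> (\<integral>\<^sup>+ w. ennreal (c * ((b + 2 * \<bar>snd w\<bar>) powr p + 1)) \<partial>P) < \<infinity>"
proof -
  assume b: "0 \<le> b"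
  have "(\<integral>\<^sup>+ w. ennreal (c * ((b + 2 * \<bar>snd w\<bar>) powr p + 1)) \<partial>P)
      = (\<integral>\<^sup>+ w. ennreal c * (ennreal ((b + 2 * \<bar>snd w\<bar>) powr p) + 1) \<partial>P)"
    using c_pos by (simp add: ennreal_mult ennreal_plus flip: ennreal_1)
  also have "\<dots> = ennreal c * ((\<integral>\<^sup>+ w. ennreal ((b + 2 * \<bar>snd w\<bar>) powr p) \<partial>P) + 1)"
    by (simp add: nn_integral_cmult nn_integral_add P.emeasure_space_1)
  also have "\<dots> < \<infinity>"
    using nn_integral_moment_finite[OF b, of 2] by (auto simp: ennreal_mult_less_top)
  finally show ?thesis .
qed

definition tail :: "real \<Rightarrow> ennreal" where
  "tail B = (\<integral>\<^sup>+ w. ennreal (c * ((2 * \<bar>snd w\<bar>) powr p + 1)) * indicator {w. B < \<bar>snd w\<bar>} w \<partial>P)"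

lemma tail_tendsto_0:
  assumes "filterlim B at_top sequentially"
  shows "(\<lambda>n. tail (B n)) \<longlonglongrightarrow> 0"
proof -
  let ?u = "\<lambda>w. ennreal (c * ((2 * \<bar>snd w\<bar>) powr p + 1))"
  have "(\<lambda>n. \<integral>\<^sup>+ w. ?u w * indicator {w. B n < \<bar>snd w\<bar>} w \<partial>P) \<longlonglongrightarrow> (\<integral>\<^sup>+ w. 0 \<partial>P)"
  proof (rule nn_integral_dominated_convergence[where w = ?u])
    show "AE w in P. (\<lambda>n. ?u w * indicator {w. B n < \<bar>snd w\<bar>} w) \<longlonglongrightarrow> 0"
    proof (rule AE_I2, rule tendsto_eventually)
      fix w
      show "\<forall>\<^sub>F n in sequentially. ?u w * indicator {w. B n < \<bar>snd w\<bar>} w = 0"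
        using filterlim_at_top[THEN iffD1, rule_format, OF assms, of "\<bar>snd w\<bar>"]
        by (rule eventually_mono) simp
    qed
    show "(\<integral>\<^sup>+ w. ?u w \<partial>P) < \<infinity>"
      using envelope_finite[of 0] by simp
    show "AE w in P. ?u w * indicator {w. B j < \<bar>snd w\<bar>} w \<le> ?u w" for j
      by (auto intro!: AE_I2 split: split_indicator)
  qed measurable
  then show ?thesis
    by (simp add: tail_def)
qed

lemma svm_sample_eval_measurable:
  assumes "0 < lam"
  shows "(\<lambda>q. svm L H ip lam n (fst q) (fst (snd q))) \<in> borel_measurable (sample_law n \<Otimes>\<^sub>M P)"
  using svm_measurable[OF assms] by (simp add: case_prod_beta')

lemma risk_svm_measurable:
  assumes lam: "0 < lam"
  shows "(\<lambda>z. risk L P (svm L H ip lam n z)) \<in> borel_measurable (sample_law n)"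
proof -
  note [measurable] = svm_sample_eval_measurable[OF lam]
  have "(\<lambda>(z, w). ennreal (l (snd w - svm L H ip lam n z (fst w)))) \<in> borel_measurable (sample_law n \<Otimes>\<^sub>M P)"
    unfolding case_prod_beta' by measurable
  then show ?thesis
    unfolding risk_eq by (rule P.borel_measurable_nn_integral)
qed

text \<open>
  Exchanging the test point with the \<open>i\<close>-th sample point turns the expected risk of the estimator into
  its expected loss at a training point, up to the effect of replacing one sample point, which
  is controlled by stability.
\<close>

lemma truncated_risk_swap:
  fixes lam M B :: real and n :: nat
  defines "F \<equiv> svm L H ip lam n"
  assumes i: "i < n" and lam: "0 < lam" and M: "0 \<le> M" and B: "1 \<le> B"
    and MB: "\<kappa> * sqrt ((M + 1) / lam) \<le> B" and nB: "c * (B powr p + 1) \<le> real n"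
  shows "(\<integral>\<^sup>+ z. (\<integral>\<^sup>+ w. (if zero_risk n z \<le> M \<and> \<bar>snd w\<bar> \<le> B
          then ennreal (l (snd w - F z (fst w))) else 0) \<partial>P) \<partial>sample_law n)
    \<le> (\<integral>\<^sup>+ z. ennreal (l (snd (z i) - F z (fst (z i)))) \<partial>sample_law n)
        + ennreal (stab_const B lam n) * (1 + shifted_moment)"
proof -
  interpret S: prob_space "sample_law n"
    by (rule prob_space_sample_law)
  define \<Phi> where "\<Phi> = (\<lambda>(z, w). if zero_risk n z \<le> M \<and> \<bar>snd w\<bar> \<le> B
          then ennreal (l (snd w - F z (fst w))) else 0)"
  have Fm [measurable]: "(\<lambda>q. F (fst q) (fst (snd q))) \<in> borel_measurable (sample_law n \<Otimes>\<^sub>M P)"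
    unfolding F_def by (rule svm_sample_eval_measurable[OF lam])
  have [measurable]: "\<Phi> \<in> borel_measurable (sample_law n \<Otimes>\<^sub>M P)"
    unfolding \<Phi>_def case_prod_beta' by measurable
  have stab_nonneg: "0 \<le> stab_const B lam n"
    unfolding stab_const_def using lam by simp
  \<comment> \<open>Evaluating the estimator at one of its own training points is the jointly
    measurable evaluation restricted to the graph of the coordinate map.\<close>
  have comp: "(\<lambda>z. (z, z i)) \<in> sample_law n \<rightarrow>\<^sub>M sample_law n \<Otimes>\<^sub>M P"
    by (rule measurable_Pair) (use i in \<open>auto intro!: measurable_component_singleton\<close>)
  have diag [measurable]: "(\<lambda>z. F z (fst (z i))) \<in> borel_measurable (sample_law n)"
    using measurable_compose[OF comp Fm] by simp
  have "(\<lambda>z. snd (z i)) \<in> borel_measurable (sample_law n)"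
    by (intro measurable_compose[OF _ snd_measurable] measurable_component_singleton) (use i in simp)
  then have diag_loss: "(\<lambda>z. ennreal (l (snd (z i) - F z (fst (z i))))) \<in> borel_measurable (sample_law n)"
    by measurable
  have point: "\<Phi> (z(i := w), z i) \<le> ennreal (l (snd (z i) - F z (fst (z i))))
      + ennreal (stab_const B lam n) * (1 + ennreal ((1 + \<bar>snd w\<bar>) powr p))"
    if "z \<in> space (sample_law n)" "w \<in> space P" for z w
  proof (cases "zero_risk n (z(i := w)) \<le> M \<and> \<bar>snd (z i)\<bar> \<le> B")
    case True
    have z: "z \<in> samples n" and w: "w \<in> X \<times> Y"
      using that by (auto simp: space_P dest: space_sample_law)
    have z': "z(i := w) \<in> samples n"
      using z w by (rule samples_upd)
    have n: "0 < real n"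
      using i by simp
    \<comment> \<open>After the exchange, the event bounds the empirical risk of zero for
      \<open>z(i := w)\<close> only, while stability also needs the bound for \<open>z\<close>.
      Putting \<open>z i\<close> back raises the average by at most this loss divided by
      \<open>n\<close>, hence by at most \<open>1\<close>: the origin of \<open>M + 1\<close> and of
      the condition \<open>nB\<close>.\<close>
    have "l (snd (z i)) \<le> c * (B powr p + 1)"
    proof (rule order_trans[OF l_upper], rule mult_left_mono)
      show "\<bar>snd (z i)\<bar> powr p + 1 \<le> B powr p + 1"
        using True p_ge_1 by (simp add: powr_mono2)
    qed (use c_pos in simp)
    then have li: "l (snd (z i)) \<le> real n"
      using nB by linarith
    have "(\<Sum>j<n. l (snd (z j))) = (\<Sum>j<n. l (snd ((z(i := w)) j))) - l (snd w) + l (snd (z i))"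
      using i by (simp add: sum.remove[of "{..<n}" i])
    then have "(\<Sum>j<n. l (snd (z j))) \<le> (\<Sum>j<n. l (snd ((z(i := w)) j))) + real n"
      using li l_nonneg[of "snd w"] by linarith
    then have "zero_risk n z \<le> zero_risk n (z(i := w)) + 1"
      unfolding zero_risk_def using n by (simp add: field_simps)
    then have zr: "zero_risk n z \<le> M + 1" "zero_risk n (z(i := w)) \<le> M + 1"
      using True by auto
    have bound: "\<bar>svm L H ip lam n v x\<bar> \<le> B" if v: "v \<in> samples n" "zero_risk n v \<le> M + 1" and x: "x \<in> X" for v x
    proof -
      have "\<bar>svm L H ip lam n v x\<bar> \<le> \<kappa> * hnorm ip (svm L H ip lam n v)"
        by (rule abs_eval_le_kappa[OF svm_mem[OF v(1) lam] x])
      also have "\<dots> \<le> \<kappa> * sqrt ((M + 1) / lam)"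
        using \<kappa>_ge_1 by (intro mult_left_mono svm_hnorm_le[OF v(1) lam v(2)]) auto
      finally show ?thesis
        using MB by linarith
    qed
    have "l (snd (z i) - F (z(i := w)) (fst (z i))) \<le> l (snd (z i) - F z (fst (z i)))
        + stab_const B lam n * (1 + (1 + \<bar>snd w\<bar>) powr p)"
      unfolding F_def using True by (intro svm_stability z w i lam B bound z' zr) auto
    then have "ennreal (l (snd (z i) - F (z(i := w)) (fst (z i)))) \<le> ennreal (l (snd (z i) - F z (fst (z i)))
        + stab_const B lam n * (1 + (1 + \<bar>snd w\<bar>) powr p))"
      by (rule ennreal_leI)
    also have "\<dots> = ennreal (l (snd (z i) - F z (fst (z i))))
        + ennreal (stab_const B lam n) * (1 + ennreal ((1 + \<bar>snd w\<bar>) powr p))"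
      using stab_nonneg l_nonneg by (simp add: ennreal_plus ennreal_mult flip: ennreal_1)
    finally show ?thesis
      using True by (simp add: \<Phi>_def)
  qed (auto simp: \<Phi>_def)
  have "(\<integral>\<^sup>+ z. (\<integral>\<^sup>+ w. \<Phi> (z, w) \<partial>P) \<partial>sample_law n)
      = (\<integral>\<^sup>+ z. (\<integral>\<^sup>+ w. \<Phi> (z(i := w), z i) \<partial>P) \<partial>sample_law n)"
    using i by (intro nn_integral_PiM_swap P.prob_space_axioms) auto
  also have "\<dots> \<le> (\<integral>\<^sup>+ z. (\<integral>\<^sup>+ w. ennreal (l (snd (z i) - F z (fst (z i))))
      + ennreal (stab_const B lam n) * (1 + ennreal ((1 + \<bar>snd w\<bar>) powr p)) \<partial>P) \<partial>sample_law n)"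
    by (intro nn_integral_mono point)
  also have "\<dots> = (\<integral>\<^sup>+ z. ennreal (l (snd (z i) - F z (fst (z i))))
      + ennreal (stab_const B lam n) * (1 + shifted_moment) \<partial>sample_law n)"
    by (simp add: nn_integral_add nn_integral_cmult P.emeasure_space_1 shifted_moment_def)
  also have "\<dots> = (\<integral>\<^sup>+ z. ennreal (l (snd (z i) - F z (fst (z i)))) \<partial>sample_law n)
      + ennreal (stab_const B lam n) * (1 + shifted_moment)"
    using diag_loss by (simp add: nn_integral_add S.emeasure_space_1)
  finally show ?thesis
    by (simp add: \<Phi>_def)
qed

text \<open>The truncated part is handled by the exchange. On the event, the part with large labels
  is at most \<open>tail B\<close>, independently of the sample.\<close>

lemma expected_risk_le:
  fixes lam M B :: real
  assumes n: "1 \<le> n" and lam: "0 < lam" and M: "0 \<le> M" and B: "1 \<le> B"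
    and MB: "\<kappa> * sqrt ((M + 1) / lam) \<le> B" and nB: "c * (B powr p + 1) \<le> real n" and g: "g \<in> H"
  shows "(\<integral>\<^sup>+ z. (if zero_risk n z \<le> M then risk L P (svm L H ip lam n z) else 0) \<partial>sample_law n)
    \<le> risk L P g + ennreal (lam * (hnorm ip g)\<^sup>2)
      + ennreal (stab_const B lam n) * (1 + shifted_moment) + tail B"
proof -
  interpret S: prob_space "sample_law n"
    by (rule prob_space_sample_law)
  define F where "F = svm L H ip lam n"
  define I where "I = (\<integral>\<^sup>+ z. (\<integral>\<^sup>+ w. (if zero_risk n z \<le> M \<and> \<bar>snd w\<bar> \<le> B
          then ennreal (l (snd w - F z (fst w))) else 0) \<partial>P) \<partial>sample_law n)"
  define s where "s = ennreal (stab_const B lam n) * (1 + shifted_moment)"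
  have Fm [measurable]: "(\<lambda>q. F (fst q) (fst (snd q))) \<in> borel_measurable (sample_law n \<Otimes>\<^sub>M P)"
    unfolding F_def by (rule svm_sample_eval_measurable[OF lam])
  have inner [measurable]: "(\<lambda>z. (\<integral>\<^sup>+ w. (if zero_risk n z \<le> M \<and> \<bar>snd w\<bar> \<le> B
          then ennreal (l (snd w - F z (fst w))) else 0) \<partial>P)) \<in> borel_measurable (sample_law n)"
    by (rule P.borel_measurable_nn_integral) (unfold case_prod_beta', measurable)
  have split: "(if zero_risk n z \<le> M then risk L P (F z) else 0)
      \<le> (\<integral>\<^sup>+ w. (if zero_risk n z \<le> M \<and> \<bar>snd w\<bar> \<le> B
          then ennreal (l (snd w - F z (fst w))) else 0) \<partial>P) + tail B"
    if zs: "z \<in> space (sample_law n)" for z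
  proof (cases "zero_risk n z \<le> M")
    case True
    have z: "z \<in> samples n"
      using zs by (rule space_sample_law)
    have "ennreal (l (snd w - F z (fst w))) \<le> (if zero_risk n z \<le> M \<and> \<bar>snd w\<bar> \<le> B
          then ennreal (l (snd w - F z (fst w))) else 0)
        + ennreal (c * ((2 * \<bar>snd w\<bar>) powr p + 1)) * indicator {w. B < \<bar>snd w\<bar>} w"
      if w: "w \<in> space P" for w
    proof (cases "\<bar>snd w\<bar> \<le> B")
      \<comment> \<open>Here \<open>\<bar>F z (fst w)\<bar> \<le> B < \<bar>snd w\<bar>\<close>, so
        the residual is controlled by the label alone.\<close>
      case False
      have x: "fst w \<in> X"
        using w by (auto simp: space_P)
      have "zero_risk n z \<le> M + 1"
        using True by simp
      then have "\<bar>F z (fst w)\<bar> \<le> \<kappa> * sqrt ((M + 1) / lam)"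
        unfolding F_def using \<kappa>_ge_1
        by (intro order_trans[OF abs_eval_le_kappa[OF svm_mem[OF z lam] x]] mult_left_mono svm_hnorm_le z lam) auto
      then have "\<bar>snd w - F z (fst w)\<bar> \<le> 2 * \<bar>snd w\<bar>"
        using MB False by linarith
      then have "\<bar>snd w - F z (fst w)\<bar> powr p \<le> (2 * \<bar>snd w\<bar>) powr p"
        using p_ge_1 by (intro powr_mono2) auto
      then have "l (snd w - F z (fst w)) \<le> c * ((2 * \<bar>snd w\<bar>) powr p + 1)"
        using c_pos by (intro order_trans[OF l_upper]) simp
      then show ?thesis
        using False by (simp add: ennreal_leI)
    qed (use True in simp)
    then have "risk L P (F z) \<le> (\<integral>\<^sup>+ w. ((if zero_risk n z \<le> M \<and> \<bar>snd w\<bar> \<le> B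
          then ennreal (l (snd w - F z (fst w))) else 0)
        + ennreal (c * ((2 * \<bar>snd w\<bar>) powr p + 1)) * indicator {w. B < \<bar>snd w\<bar>} w) \<partial>P)"
      unfolding risk_eq by (rule nn_integral_mono)
    also have "\<dots> = (\<integral>\<^sup>+ w. (if zero_risk n z \<le> M \<and> \<bar>snd w\<bar> \<le> B
          then ennreal (l (snd w - F z (fst w))) else 0) \<partial>P) + tail B"
    proof -
      have [measurable]: "(\<lambda>w. F z (fst w)) \<in> borel_measurable P"
        unfolding F_def by (rule measurable_fst_compose[OF H_measurable[OF svm_mem[OF z lam]]])
      show ?thesis
        unfolding tail_def by (rule nn_integral_add) measurable
    qed
    finally show ?thesis
      using True by simp
  qed simp
  have swap: "I \<le> (\<integral>\<^sup>+ z. ennreal (l (snd (z i) - F z (fst (z i)))) \<partial>sample_law n) + s"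
    if "i < n" for i
    unfolding I_def s_def F_def by (rule truncated_risk_swap[OF that lam M B MB nB])
  have diag: "(\<lambda>z. ennreal (l (snd (z i) - F z (fst (z i))))) \<in> borel_measurable (sample_law n)"
    if "i < n" for i
  proof -
    have "(\<lambda>z. (z, z i)) \<in> sample_law n \<rightarrow>\<^sub>M sample_law n \<Otimes>\<^sub>M P"
      by (rule measurable_Pair) (use that in \<open>auto intro!: measurable_component_singleton\<close>)
    from measurable_compose[OF this Fm] have [measurable]: "(\<lambda>z. F z (fst (z i))) \<in> borel_measurable (sample_law n)"
      by simp
    have [measurable]: "(\<lambda>z. snd (z i)) \<in> borel_measurable (sample_law n)"
      by (intro measurable_compose[OF _ snd_measurable] measurable_component_singleton) (use that in simp)
    show ?thesis
      by measurable
  qed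
  have one: "ennreal (1 / real n) * of_nat n = 1"
    using n by (simp add: ennreal_of_nat_eq_real_of_nat flip: ennreal_mult)
  \<comment> \<open>\<open>I\<close> does not depend on \<open>i\<close>. Averaging the
    \<open>n\<close> exchange bounds therefore assembles the expected empirical risk, the only
    quantity to which minimality applies.\<close>
  have "ennreal (1 / real n) * (\<Sum>i<n. I) \<le> ennreal (1 / real n) *
      (\<Sum>i<n. (\<integral>\<^sup>+ z. ennreal (l (snd (z i) - F z (fst (z i)))) \<partial>sample_law n) + s)"
    by (intro mult_left_mono sum_mono swap) auto
  then have "I \<le> ennreal (1 / real n) *
      (\<Sum>i<n. (\<integral>\<^sup>+ z. ennreal (l (snd (z i) - F z (fst (z i)))) \<partial>sample_law n)) + s"
    by (simp add: sum.distrib distrib_left one flip: mult.assoc)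
  also have "ennreal (1 / real n) *
      (\<Sum>i<n. (\<integral>\<^sup>+ z. ennreal (l (snd (z i) - F z (fst (z i)))) \<partial>sample_law n))
    = (\<integral>\<^sup>+ z. ennreal (1 / real n) * (\<Sum>i<n. ennreal (l (snd (z i) - F z (fst (z i))))) \<partial>sample_law n)"
    using diag by (intro nn_integral_cmult_sum[symmetric]) auto
  also have "\<dots> \<le> (\<integral>\<^sup>+ z. ennreal (1 / real n * (\<Sum>i<n. l (snd (z i) - g (fst (z i)))))
      + ennreal (lam * (hnorm ip g)\<^sup>2) \<partial>sample_law n)"
  proof (rule nn_integral_mono)
    fix z assume "z \<in> space (sample_law n)"
    then have z: "z \<in> samples n"
      by (rule space_sample_law)
    \<comment> \<open>The penalty of the estimator is discarded; that of the competitor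
      \<open>g\<close> remains.\<close>
    have "0 \<le> lam * (hnorm ip (F z))\<^sup>2"
      using lam by simp
    then have "1 / real n * (\<Sum>i<n. l (snd (z i) - F z (fst (z i))))
        \<le> 1 / real n * (\<Sum>i<n. l (snd (z i) - g (fst (z i)))) + lam * (hnorm ip g)\<^sup>2"
      using svm_le[OF z lam g] unfolding F_def reg_emp_risk_eq[OF z] by linarith
    then show "ennreal (1 / real n) * (\<Sum>i<n. ennreal (l (snd (z i) - F z (fst (z i)))))
        \<le> ennreal (1 / real n * (\<Sum>i<n. l (snd (z i) - g (fst (z i))))) + ennreal (lam * (hnorm ip g)\<^sup>2)"
      using lam l_nonneg
      by (subst sum_ennreal) (auto simp: ennreal_leI sum_nonneg simp flip: ennreal_mult ennreal_plus)
  qed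
  also have "\<dots> = risk L P g + ennreal (lam * (hnorm ip g)\<^sup>2)"
  proof -
    have "(\<lambda>z. l (snd (z i) - g (fst (z i)))) \<in> borel_measurable (sample_law n)" if "i < n" for i
    proof -
      have lg: "(\<lambda>w. l (snd w - g (fst w))) \<in> borel_measurable P"
        using measurable_fst_compose[OF H_measurable[OF g]] by measurable
      show ?thesis
        by (rule measurable_compose[where f = "\<lambda>z. z i", OF _ lg]) (use that in simp)
    qed
    then have "(\<lambda>z. ennreal (1 / real n * (\<Sum>i<n. l (snd (z i) - g (fst (z i)))))) \<in> borel_measurable (sample_law n)"
      by (intro measurable_compose[OF _ measurable_ennreal] borel_measurable_times borel_measurable_sum) auto
    then show ?thesis
      by (simp add: nn_integral_add S.emeasure_space_1 nn_integral_emp_risk[OF n H_measurable[OF g], simplified])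
  qed
  finally have I: "I \<le> risk L P g + ennreal (lam * (hnorm ip g)\<^sup>2) + s"
    by (simp add: add_right_mono)
  have "(\<integral>\<^sup>+ z. (if zero_risk n z \<le> M then risk L P (F z) else 0) \<partial>sample_law n)
      \<le> (\<integral>\<^sup>+ z. (\<integral>\<^sup>+ w. (if zero_risk n z \<le> M \<and> \<bar>snd w\<bar> \<le> B
          then ennreal (l (snd w - F z (fst w))) else 0) \<partial>P) + tail B \<partial>sample_law n)"
    by (intro nn_integral_mono split)
  also have "\<dots> = I + tail B"
    unfolding I_def using inner by (simp add: nn_integral_add S.emeasure_space_1)
  finally show ?thesis
    using I unfolding F_def s_def by (meson add_right_mono order_trans)
qed

end

subsection \<open>Approximating the Bayes risk\<close>

text \<open>For an indicator, regularity gives a compact \<open>K\<close> inside \<open>A\<close>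
  and an open \<open>U\<close> around it with \<open>U - K\<close> small. A Urysohn function for
  \<open>K\<close> and the complement of \<open>U\<close> differs from the indicator only on
  \<open>U - K\<close>. Sums and dominated limits extend this to integrable functions.\<close>

lemma continuous_L1_dense:
  fixes N :: "'a::euclidean_space measure" and f :: "'a \<Rightarrow> real"
  assumes "finite_measure N" and sets_N [measurable_cong]: "sets N = sets borel"
    and "integrable N f" and "0 < e"
  shows "\<exists>g. continuous_on UNIV g \<and> integrable N g \<and> (\<integral>x. \<bar>f x - g x\<bar> \<partial>N) < e"
  using assms(3,4)
proof (induction arbitrary: e rule: integrable_induct)
  case (base A c)
  interpret finite_measure N by fact
  have A: "A \<in> sets borel"
    using base(1) by (simp add: sets_N)
  have fin: "emeasure N (space N) \<noteq> \<infinity>"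
    by simp
  \<comment> \<open>The gap \<open>U - K\<close> has measure below \<open>2 * \<delta>\<close>, and
    \<open>\<bar>c\<bar> * (2 * \<delta>) < e\<close>; the added \<open>1\<close> covers
    \<open>c = 0\<close>.\<close>
  define \<delta> where "\<delta> = e / (2 * (\<bar>c\<bar> + 1))"
  have \<delta>: "0 < \<delta>"
    using base(3) by (simp add: \<delta>_def)
  have fin_A: "emeasure N A \<noteq> \<infinity>"
    using base(2) by simp
  have "\<exists>K\<in>{K. K \<subseteq> A \<and> compact K}. emeasure N A < emeasure N K + ennreal \<delta>"
    by (rule SUP_approx_ennreal[OF \<delta> _ inner_regular[OF sets_N fin A] fin_A]) auto
  then obtain K where K: "K \<subseteq> A" "compact K" "emeasure N A < emeasure N K + ennreal \<delta>"
    by blast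
  have "\<exists>U\<in>{U. A \<subseteq> U \<and> open U}. emeasure N U < emeasure N A + ennreal \<delta>"
    by (rule INF_approx_ennreal[OF \<delta> outer_regular[OF sets_N fin A] fin_A])
  then obtain U where U: "A \<subseteq> U" "open U" "emeasure N U < emeasure N A + ennreal \<delta>"
    by blast
  have Km: "K \<in> sets N" and Um: "U \<in> sets N" and Am: "A \<in> sets N"
    using K(2) U(2) A by (auto simp: sets_N intro: compact_imp_closed borel_closed)
  have "measure N A < measure N K + \<delta>" "measure N U < measure N A + \<delta>"
    using K(3) U(3) \<delta> by (simp_all add: emeasure_eq_measure ennreal_less_iff flip: ennreal_plus)
  moreover have "measure N (U - K) = measure N U - measure N K"
    using K(1) U(1) Km Um by (intro finite_measure_Diff) auto
  ultimately have UK: "measure N (U - K) < 2 * \<delta>"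
    by simp
  obtain g :: "'a \<Rightarrow> real" where g: "continuous_on UNIV g" "\<And>x. g x \<in> closed_segment 0 1"
      "\<And>x. x \<in> - U \<Longrightarrow> g x = 0" "\<And>x. x \<in> K \<Longrightarrow> g x = 1"
    using Urysohn[of "- U" K 0 1] K U by (auto simp: compact_imp_closed closed_Compl)
  have g01: "0 \<le> g x" "g x \<le> 1" for x
    using g(2)[of x] by (auto simp: closed_segment_eq_real_ivl)
  have gm: "g \<in> borel_measurable N"
    using borel_measurable_continuous_onI[OF g(1)] by (simp add: measurable_cong_sets[OF sets_N refl])
  have gi: "integrable N (\<lambda>x. c * g x)"
    by (rule integrable_const_bound[of _ "\<bar>c\<bar>"]) (use gm g01 in \<open>auto simp: abs_mult mult_left_le\<close>)
  have "(\<integral>x. \<bar>indicator A x *\<^sub>R c - c * g x\<bar> \<partial>N) \<le> (\<integral>x. \<bar>c\<bar> * indicator (U - K) x \<partial>N)"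
  proof (rule integral_mono)
    show "integrable N (\<lambda>x. \<bar>indicator A x *\<^sub>R c - c * g x\<bar>)"
      using gi Am by (intro integrable_abs integrable_diff) (auto simp: emeasure_eq_measure)
    show "integrable N (\<lambda>x. \<bar>c\<bar> * indicator (U - K) x)"
      using Km Um by (auto simp: emeasure_eq_measure)
    fix x
    show "\<bar>indicator A x *\<^sub>R c - c * g x\<bar> \<le> \<bar>c\<bar> * indicator (U - K) x"
    proof (cases "x \<in> U - K")
      case True
      have "\<bar>indicator A x - g x\<bar> \<le> 1"
        using g01[of x] by (auto split: split_indicator)
      then have "\<bar>c\<bar> * \<bar>indicator A x - g x\<bar> \<le> \<bar>c\<bar> * 1"
        by (intro mult_left_mono) auto
      moreover have "\<bar>indicator A x *\<^sub>R c - c * g x\<bar> = \<bar>c\<bar> * \<bar>indicator A x - g x\<bar>"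
        by (simp add: abs_mult[symmetric] algebra_simps)
      ultimately show ?thesis
        using True by simp
    next
      case False
      then have "indicator A x = g x"
        using g(3,4)[of x] K(1) U(1) by (auto split: split_indicator)
      then show ?thesis
        by simp
    qed
  qed
  also have "\<dots> = \<bar>c\<bar> * measure N (U - K)"
    using Km Um by (simp add: sets.Int_space_eq2)
  also have "\<dots> \<le> \<bar>c\<bar> * (2 * \<delta>)"
    using UK by (intro mult_left_mono) auto
  also have "\<dots> < e"
    using base(3) by (simp add: \<delta>_def field_simps)
  finally show ?case
    using gi g(1) by (intro exI[of _ "\<lambda>x. c * g x"]) (auto intro!: continuous_intros)
next
  case (add f1 f2)
  obtain g1 where g1: "continuous_on UNIV g1" "integrable N g1" "(\<integral>x. \<bar>f1 x - g1 x\<bar> \<partial>N) < e / 2"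
    using add(3)[of "e / 2"] add(5) by auto
  obtain g2 where g2: "continuous_on UNIV g2" "integrable N g2" "(\<integral>x. \<bar>f2 x - g2 x\<bar> \<partial>N) < e / 2"
    using add(4)[of "e / 2"] add(5) by auto
  have "(\<integral>x. \<bar>f1 x + f2 x - (g1 x + g2 x)\<bar> \<partial>N) \<le> (\<integral>x. \<bar>f1 x - g1 x\<bar> + \<bar>f2 x - g2 x\<bar> \<partial>N)"
    using add(1,2) g1(2) g2(2) by (intro integral_mono integrable_abs integrable_diff integrable_add) auto
  also have "\<dots> = (\<integral>x. \<bar>f1 x - g1 x\<bar> \<partial>N) + (\<integral>x. \<bar>f2 x - g2 x\<bar> \<partial>N)"
    using add(1,2) g1(2) g2(2) by (intro Bochner_Integration.integral_add integrable_abs integrable_diff) auto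
  finally show ?case
    using g1 g2 by (intro exI[of _ "\<lambda>x. g1 x + g2 x"]) (auto intro!: continuous_intros)
next
  case (lim f s)
  have "(\<lambda>i. \<integral>x. \<bar>f x - s i x\<bar> \<partial>N) \<longlonglongrightarrow> (\<integral>x. 0 \<partial>N)"
  proof (rule integral_dominated_convergence[where w = "\<lambda>x. 3 * \<bar>f x\<bar>"])
    show "AE x in N. (\<lambda>i. \<bar>f x - s i x\<bar>) \<longlonglongrightarrow> 0"
    proof (rule AE_I2)
      fix x assume "x \<in> space N"
      then have "(\<lambda>i. \<bar>f x - s i x\<bar>) \<longlonglongrightarrow> \<bar>f x - f x\<bar>"
        by (intro tendsto_intros lim(2))
      then show "(\<lambda>i. \<bar>f x - s i x\<bar>) \<longlonglongrightarrow> 0"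
        by simp
    qed
    \<comment> \<open>The induction principle supplies simple functions with
      \<open>\<bar>s i x\<bar> \<le> 2 * \<bar>f x\<bar>\<close>.\<close>
    show "AE x in N. norm \<bar>f x - s i x\<bar> \<le> 3 * \<bar>f x\<bar>" for i
      using lim(3)[of _ i] by (intro AE_I2) (smt (verit) real_norm_def)
  qed (use lim(1,4) in auto)
  then have "(\<lambda>i. \<integral>x. \<bar>f x - s i x\<bar> \<partial>N) \<longlonglongrightarrow> 0"
    by simp
  then have "\<forall>\<^sub>F i in sequentially. (\<integral>x. \<bar>f x - s i x\<bar> \<partial>N) < e / 2"
    by (rule order_tendstoD) (use lim(6) in simp)
  then obtain i where i: "(\<integral>x. \<bar>f x - s i x\<bar> \<partial>N) < e / 2"
    by (auto simp: eventually_sequentially)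
  obtain g where g: "continuous_on UNIV g" "integrable N g" "(\<integral>x. \<bar>s i x - g x\<bar> \<partial>N) < e / 2"
    using lim(5)[of "e / 2" i] lim(6) by auto
  have "(\<integral>x. \<bar>f x - g x\<bar> \<partial>N) \<le> (\<integral>x. \<bar>f x - s i x\<bar> + \<bar>s i x - g x\<bar> \<partial>N)"
    using lim(1,4) g(2) by (intro integral_mono integrable_abs integrable_diff integrable_add) auto
  also have "\<dots> = (\<integral>x. \<bar>f x - s i x\<bar> \<partial>N) + (\<integral>x. \<bar>s i x - g x\<bar> \<partial>N)"
    using lim(1,4) g(2) by (intro Bochner_Integration.integral_add integrable_abs integrable_diff) auto
  finally show ?case
    using i g by (intro exI[of _ g]) auto
qed

text \<open>Closeness in \<open>L1\<close> does not control a loss of order \<open>p\<close>, hence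
  the uniform bound and almost sure convergence. A subsequence of the \<open>L1\<close>
  approximations converges almost everywhere, and clipping at \<open>M\<close> keeps continuity and
  the limit.\<close>

lemma bounded_measurable_limit_of_continuous:
  fixes N :: "'a::euclidean_space measure" and f :: "'a \<Rightarrow> real"
  assumes "finite_measure N" and sets_N: "sets N = sets borel"
    and f: "f \<in> borel_measurable borel" and M: "\<And>x. \<bar>f x\<bar> \<le> M"
  shows "\<exists>g. (\<forall>m::nat. continuous_on UNIV (g m)) \<and> (\<forall>m x. \<bar>g m x\<bar> \<le> M)
    \<and> (AE x in N. (\<lambda>m. g m x) \<longlonglongrightarrow> f x)"
proof -
  interpret finite_measure N by fact
  have fm: "f \<in> borel_measurable N"
    using f by (simp add: measurable_cong_sets[OF sets_N refl])
  have fi: "integrable N f"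
    by (rule integrable_const_bound[of _ M]) (use fm M in auto)
  have "\<exists>g. continuous_on UNIV g \<and> integrable N g \<and> (\<integral>x. \<bar>f x - g x\<bar> \<partial>N) < 1 / real (Suc m)" for m
    by (rule continuous_L1_dense[OF assms(1) sets_N fi]) simp
  then obtain g where g: "\<And>m. continuous_on UNIV (g m)" "\<And>m. integrable N (g m)"
      "\<And>m. (\<integral>x. \<bar>f x - g m x\<bar> \<partial>N) < 1 / real (Suc m)"
    by metis
  have lim: "(\<lambda>m. \<integral>x. norm (g m x - f x) \<partial>N) \<longlonglongrightarrow> 0"
  proof (rule tendsto_sandwich)
    show "\<forall>\<^sub>F m in sequentially. 0 \<le> (\<integral>x. norm (g m x - f x) \<partial>N)"
      by simp
    show "\<forall>\<^sub>F m in sequentially. (\<integral>x. norm (g m x - f x) \<partial>N) \<le> 1 / real (Suc m)"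
      using g(3) by (simp add: abs_minus_commute less_imp_le)
    show "(\<lambda>m. 1 / real (Suc m)) \<longlonglongrightarrow> 0"
      by (rule LIMSEQ_Suc[OF lim_1_over_n])
  qed simp
  obtain r :: "nat \<Rightarrow> nat" where r: "AE x in N. (\<lambda>m. g (r m) x - f x) \<longlonglongrightarrow> 0"
    using tendsto_L1_AE_subseq[OF _ lim] g(2) fi by auto
  let ?h = "\<lambda>m x. max (- M) (min M (g (r m) x))"
  have M0: "0 \<le> M"
    using M[of undefined] by linarith
  have "(\<lambda>m. ?h m x) \<longlonglongrightarrow> f x" if "(\<lambda>m. g (r m) x - f x) \<longlonglongrightarrow> 0" for x
  proof -
    have "(\<lambda>m. ?h m x) \<longlonglongrightarrow> max (- M) (min M (f x))"
      by (intro tendsto_intros LIM_zero_cancel[OF that])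
    then show ?thesis
      using M[of x] by (simp add: abs_le_iff max_def min_def split: if_splits)
  qed
  then have "AE x in N. (\<lambda>m. ?h m x) \<longlonglongrightarrow> f x"
    using r by (auto elim: eventually_mono)
  moreover have "continuous_on UNIV (?h m)" for m
    by (intro continuous_intros g)
  moreover have "\<bar>?h m x\<bar> \<le> M" for m x
    using M0 by (auto simp: abs_le_iff max_def min_def)
  ultimately show ?thesis
    by (intro exI[of _ ?h]) auto
qed

section \<open>Functions in \<open>H\<close> with nearly optimal risk\<close>

context svm_sampling
begin

lemma risk_approx:
  fixes F :: "nat \<Rightarrow> 'a \<Rightarrow> real"
  assumes F: "\<And>m. F m \<in> borel_measurable (restrict_space borel X)"
    and f: "f \<in> borel_measurable (restrict_space borel X)"
    and lim: "AE w in P. (\<lambda>m. F m (fst w)) \<longlonglongrightarrow> f (fst w)"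
    and W: "W \<in> borel_measurable P" "(\<integral>\<^sup>+ w. W w \<partial>P) < \<infinity>"
    and bound: "\<And>m w. w \<in> space P \<Longrightarrow> ennreal (l (snd w - F m (fst w))) \<le> W w"
    and fin: "risk L P f < \<infinity>" and e: "0 < e"
  shows "\<exists>m. risk L P (F m) \<le> risk L P f + ennreal e"
proof -
  note [measurable] = measurable_fst_compose[OF F] measurable_fst_compose[OF f] W(1)
  have "(\<lambda>m. risk L P (F m)) \<longlonglongrightarrow> risk L P f"
    unfolding risk_eq
  proof (rule nn_integral_dominated_convergence[where w = W])
    show "AE w in P. (\<lambda>m. ennreal (l (snd w - F m (fst w)))) \<longlonglongrightarrow> ennreal (l (snd w - f (fst w)))"
      using lim
    proof (rule AE_mp, intro AE_I2 impI)
      fix w :: "'a \<times> real"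
      assume "(\<lambda>m. F m (fst w)) \<longlonglongrightarrow> f (fst w)"
      then show "(\<lambda>m. ennreal (l (snd w - F m (fst w)))) \<longlonglongrightarrow> ennreal (l (snd w - f (fst w)))"
        by (intro tendsto_ennrealI continuous_on_tendsto_compose[OF continuous_l[of UNIV]] tendsto_intros) auto
    qed
    show "AE w in P. ennreal (l (snd w - F m (fst w))) \<le> W w" for m
      using bound by (intro AE_I2) auto
  qed (use W in measurable)
  moreover have "risk L P f < risk L P f + ennreal e"
    using fin e by (cases "risk L P f" rule: ennreal_cases) (auto simp: ennreal_less_iff simp flip: ennreal_plus)
  ultimately have "\<forall>\<^sub>F m in sequentially. risk L P (F m) < risk L P f + ennreal e"
    by (rule order_tendstoD(2))
  then show ?thesis
    by (auto simp: eventually_sequentially intro: less_imp_le)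
qed

text \<open>A convex nonnegative function vanishing at \<open>0\<close> is monotone along each ray
  from \<open>0\<close>.\<close>

lemma l_mono_segment:
  assumes "a \<in> closed_segment 0 b"
  shows "l a \<le> l b"
proof -
  obtain u where u: "0 \<le> u" "u \<le> 1" "a = u * b"
    using assms by (auto simp: in_segment)
  have "l ((1 - u) *\<^sub>R 0 + u *\<^sub>R b) \<le> (1 - u) * l 0 + u * l b"
    by (rule convex_onD[OF convex_l]) (use u in auto)
  also have "\<dots> \<le> l b"
    using u l_nonneg[of b] by (simp add: l_zero mult_left_le_one_le)
  finally show ?thesis
    using u by simp
qed

lemma l_le_envelope:
  assumes "\<bar>r\<bar> \<le> b + 2 * \<bar>y\<bar>"
  shows "l r \<le> c * ((b + 2 * \<bar>y\<bar>) powr p + 1)"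
  using assms p_ge_1 c_pos by (intro order_trans[OF l_upper]) (simp add: powr_mono2)

text \<open>If \<open>\<bar>y\<bar> \<le> m\<close>, clipping moves the residual towards
  \<open>0\<close> and cannot increase the loss. Otherwise the clipped prediction is smaller than
  the label in absolute value and the envelope with \<open>b = 0\<close> applies. The sum of the
  original loss and this envelope thus dominates for all \<open>m\<close>.\<close>

lemma risk_approx_clip:
  assumes f: "f \<in> borel_measurable (restrict_space borel X)" and fin: "risk L P f < \<infinity>" and e: "0 < e"
  shows "\<exists>m::nat. risk L P (\<lambda>x. max (- real m) (min (real m) (f x))) \<le> risk L P f + ennreal e"
proof (rule risk_approx[OF _ f _ _ _ _ fin e])
  let ?F = "\<lambda>m x. max (- real m) (min (real m) (f x))"
  let ?W = "\<lambda>w. ennreal (l (snd w - f (fst w))) + ennreal (c * ((0 + 2 * \<bar>snd w\<bar>) powr p + 1))"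
  note [measurable] = f measurable_fst_compose[OF f]
  show "?F m \<in> borel_measurable (restrict_space borel X)" for m
    by measurable
  show "?W \<in> borel_measurable P"
    by measurable
  show "AE w in P. (\<lambda>m. ?F m (fst w)) \<longlonglongrightarrow> f (fst w)"
  proof (rule AE_I2, rule tendsto_eventually)
    fix w :: "'a \<times> real"
    obtain m0 where m0: "\<bar>f (fst w)\<bar> \<le> real m0"
      using real_arch_simple by blast
    show "\<forall>\<^sub>F m in sequentially. ?F m (fst w) = f (fst w)"
      using eventually_ge_at_top[of m0]
    proof eventually_elim
      case (elim m)
      then have "real m0 \<le> real m"
        by simp
      then show ?case
        using m0 by linarith
    qed
  qed
  have "(\<integral>\<^sup>+ w. ?W w \<partial>P) = risk L P f + (\<integral>\<^sup>+ w. ennreal (c * ((0 + 2 * \<bar>snd w\<bar>) powr p + 1)) \<partial>P)"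
    unfolding risk_eq by (rule nn_integral_add) measurable
  then show "(\<integral>\<^sup>+ w. ?W w \<partial>P) < \<infinity>"
    using fin envelope_finite[of 0] by simp
  show "ennreal (l (snd w - ?F m (fst w))) \<le> ?W w" for m :: nat and w :: "'a \<times> real"
  proof -
    have "l (snd w - ?F m (fst w)) \<le> l (snd w - f (fst w)) + c * ((0 + 2 * \<bar>snd w\<bar>) powr p + 1)"
    proof (cases "\<bar>snd w\<bar> \<le> real m")
      case True
      then have "snd w - ?F m (fst w) \<in> closed_segment 0 (snd w - f (fst w))"
        by (auto simp: closed_segment_eq_real_ivl max_def min_def)
      then have "l (snd w - ?F m (fst w)) \<le> l (snd w - f (fst w))"
        by (rule l_mono_segment)
      moreover have "0 \<le> c * ((0 + 2 * \<bar>snd w\<bar>) powr p + 1)"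
        using c_pos by simp
      ultimately show ?thesis
        by linarith
    next
      case False
      then have "\<bar>snd w - ?F m (fst w)\<bar> \<le> 0 + 2 * \<bar>snd w\<bar>"
        by (auto simp: max_def min_def)
      then show ?thesis
        using l_le_envelope[of "snd w - ?F m (fst w)" 0 "snd w"] l_nonneg[of "snd w - f (fst w)"] by linarith
    qed
    then have "ennreal (l (snd w - ?F m (fst w)))
        \<le> ennreal (l (snd w - f (fst w)) + c * ((0 + 2 * \<bar>snd w\<bar>) powr p + 1))"
      by (rule ennreal_leI)
    also have "\<dots> = ?W w"
      using c_pos by (intro ennreal_plus l_nonneg) simp
    finally show ?thesis .
  qed
qed

lemma risk_approx_bounded:
  assumes F: "\<And>m. F m \<in> borel_measurable (restrict_space borel X)"
    and f: "f \<in> borel_measurable (restrict_space borel X)"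
    and lim: "AE w in P. (\<lambda>m. F m (fst w)) \<longlonglongrightarrow> f (fst w)"
    and M: "\<And>m x. x \<in> X \<Longrightarrow> \<bar>F m x\<bar> \<le> M" "0 \<le> M"
    and fin: "risk L P f < \<infinity>" and e: "0 < e"
  shows "\<exists>m. risk L P (F m) \<le> risk L P f + ennreal e"
proof (rule risk_approx[OF F f lim _ envelope_finite[OF M(2)] _ fin e])
  show "(\<lambda>w. ennreal (c * ((M + 2 * \<bar>snd w\<bar>) powr p + 1))) \<in> borel_measurable P"
    by measurable
  fix m w assume "w \<in> space P"
  then have "\<bar>F m (fst w)\<bar> \<le> M"
    by (intro M) (auto simp: space_P)
  then show "ennreal (l (snd w - F m (fst w))) \<le> ennreal (c * ((M + 2 * \<bar>snd w\<bar>) powr p + 1))"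
    by (intro ennreal_leI l_le_envelope) linarith
qed

text \<open>Three replacements at cost \<open>e / 3\<close> each: clipping, then a bounded
  continuous function, then an element of \<open>H\<close> by universality. Each stage supplies the
  finite risk or the boundedness that the next one uses for domination.\<close>

lemma risk_approx_H:
  assumes univ: "\<And>g e. continuous_on X g \<Longrightarrow> 0 < e \<Longrightarrow> \<exists>f\<in>H. \<forall>x\<in>X. \<bar>f x - g x\<bar> < e"
    and f: "f \<in> borel_measurable (restrict_space borel X)" and fin: "risk L P f < \<infinity>" and e: "0 < e"
  shows "\<exists>h\<in>H. risk L P h \<le> risk L P f + ennreal e"
proof -
  have add_e: "a + ennreal (e / 3) < \<infinity>" if "a < \<infinity>" for a
    using that by simp
  obtain m where m: "risk L P (\<lambda>x. max (- real m) (min (real m) (f x))) \<le> risk L P f + ennreal (e / 3)"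
    using risk_approx_clip[OF f fin, of "e / 3"] e by auto
  define f1 where "f1 = (\<lambda>x. max (- real m) (min (real m) (f x)))"
  have f1: "f1 \<in> borel_measurable (restrict_space borel X)"
    unfolding f1_def using f by measurable
  have f1_fin: "risk L P f1 < \<infinity>"
    using m add_e[OF fin] unfolding f1_def by (rule order.strict_trans1)
  \<comment> \<open>Density of continuous functions is available for Borel measures on the whole
    space, so the marginal is pushed forward there and \<open>f1\<close> is extended by zero outside
    \<open>X\<close>.\<close>
  define N where "N = distr P borel fst"
  have Xb: "X \<in> sets borel"
    using compact_X by (simp add: compact_imp_closed)
  have f2: "(\<lambda>x. indicator X x * f1 x) \<in> borel_measurable borel"
    using f1 Xb by (subst (asm) borel_measurable_restrict_space_iff) (auto simp: mult.commute)
  have "\<exists>g. (\<forall>m::nat. continuous_on UNIV (g m)) \<and> (\<forall>j x. \<bar>g j x\<bar> \<le> real m)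
    \<and> (AE x in N. (\<lambda>m. g m x) \<longlonglongrightarrow> indicator X x * f1 x)"
  proof (rule bounded_measurable_limit_of_continuous[OF _ _ f2])
    show "finite_measure N"
      unfolding N_def by (rule P.finite_measure_distr) simp
    show "\<bar>indicator X x * f1 x\<bar> \<le> real m" for x
      by (auto simp: f1_def max_def min_def split: split_indicator)
  qed (simp add: N_def)
  then obtain g where g: "\<And>j. continuous_on UNIV (g j)" "\<And>j x. \<bar>g j x\<bar> \<le> real m"
      "AE x in N. (\<lambda>m. g m x) \<longlonglongrightarrow> indicator X x * f1 x"
    by blast
  have "\<exists>j. risk L P (g j) \<le> risk L P f1 + ennreal (e / 3)"
  proof (rule risk_approx_bounded[OF _ f1 _ g(2) _ f1_fin])
    show "g j \<in> borel_measurable (restrict_space borel X)" for j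
      using continuous_on_subset[OF g(1)] by (intro borel_measurable_continuous_on_restrict) auto
    have "AE w in P. (\<lambda>m. g m (fst w)) \<longlonglongrightarrow> indicator X (fst w) * f1 (fst w)"
      using g(3) unfolding N_def by (rule AE_distrD[rotated]) simp
    then show "AE w in P. (\<lambda>m. g m (fst w)) \<longlonglongrightarrow> f1 (fst w)"
      by (rule AE_mp) (intro AE_I2, auto simp: space_P)
  qed (use e in auto)
  then obtain j where j: "risk L P (g j) \<le> risk L P f1 + ennreal (e / 3)"
    by blast
  have gX: "continuous_on X (g j)"
    using continuous_on_subset[OF g(1)] by blast
  have gX_fin: "risk L P (g j) < \<infinity>"
    using j add_e[OF f1_fin] by (rule order.strict_trans1)
  have "\<exists>h\<in>H. \<forall>x\<in>X. \<bar>h x - g j x\<bar> < 1 / real (Suc i)" for i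
    by (rule univ[OF gX]) simp
  then obtain h where h: "\<And>i. h i \<in> H" "\<And>i x. x \<in> X \<Longrightarrow> \<bar>h i x - g j x\<bar> < 1 / real (Suc i)"
    by metis
  have "\<exists>i. risk L P (h i) \<le> risk L P (g j) + ennreal (e / 3)"
  proof (rule risk_approx_bounded[OF H_measurable[OF h(1)] _ _ _ _ gX_fin])
    show "g j \<in> borel_measurable (restrict_space borel X)"
      using gX by (rule borel_measurable_continuous_on_restrict)
    show "\<bar>h i x\<bar> \<le> real m + 1" if "x \<in> X" for i x
    proof -
      have "1 / real (Suc i) \<le> 1"
        by simp
      then show ?thesis
        using h(2)[OF that, of i] g(2)[of j x] by linarith
    qed
    show "AE w in P. (\<lambda>i. h i (fst w)) \<longlonglongrightarrow> g j (fst w)"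
    proof (rule AE_I2)
      fix w assume "w \<in> space P"
      then have w: "fst w \<in> X"
        by (auto simp: space_P)
      show "(\<lambda>i. h i (fst w)) \<longlonglongrightarrow> g j (fst w)"
        by (rule LIM_zero_cancel, rule Lim_null_comparison[OF _ LIMSEQ_Suc[OF lim_1_over_n]])
          (use h(2)[OF w] in \<open>simp add: less_imp_le\<close>)
    qed
  qed (use e in auto)
  then obtain i where i: "risk L P (h i) \<le> risk L P (g j) + ennreal (e / 3)"
    by blast
  have "risk L P (h i) \<le> ((risk L P f + ennreal (e / 3)) + ennreal (e / 3)) + ennreal (e / 3)"
    using i j m unfolding f1_def[symmetric] by (meson add_right_mono order_trans)
  also have "\<dots> = risk L P f + ennreal e"
    using e by (simp add: add.assoc flip: ennreal_plus)
  finally show ?thesis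
    using h(1) by blast
qed

end

subsection \<open>Consistency\<close>

context svm_sampling
begin

text \<open>Markov's inequality is applied on the event \<open>W\<close> only. There the risk is at
  least \<open>r\<close>, and at least \<open>r + e\<close> on \<open>Ev\<close>, while its integral
  over \<open>W\<close> is at most \<open>r + \<theta>\<close>. The mass missing from
  \<open>W\<close> costs \<open>r * c0 / M\<close>; Markov for \<open>zero_risk\<close> bounds that
  mass by \<open>c0 / M\<close>.\<close>

lemma deviation_prob_le:
  fixes r \<theta> c0 e M lam :: real and n :: nat
  defines "Ev \<equiv> {z \<in> space (sample_law n).
      \<bar>enn2ereal (risk L P (svm L H ip lam n z)) - enn2ereal (bayes_risk X L P)\<bar> > ereal e}"
  assumes n: "1 \<le> n" and lam: "0 < lam" and M: "0 < M" and e: "0 < e"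
    and r: "bayes_risk X L P = ennreal r" "0 \<le> r"
    and c0: "risk L P (\<lambda>x. 0) = ennreal c0" "0 \<le> c0" and \<theta>: "0 \<le> \<theta>"
    and le: "(\<integral>\<^sup>+ z. (if zero_risk n z \<le> M then risk L P (svm L H ip lam n z) else 0) \<partial>sample_law n)
      \<le> ennreal (r + \<theta>)"
  shows "measure (sample_law n) Ev \<le> c0 / M + (r * c0 / M + \<theta>) / e"
proof -
  interpret S: prob_space "sample_law n"
    by (rule prob_space_sample_law)
  note [measurable] = risk_svm_measurable[OF lam]
  let ?R = "\<lambda>z. risk L P (svm L H ip lam n z)"
  define W where "W = {z \<in> space (sample_law n). zero_risk n z \<le> M}"
  have Ev [measurable]: "Ev \<in> sets (sample_law n)"
    unfolding Ev_def by measurable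
  have W [measurable]: "W \<in> sets (sample_law n)"
    unfolding W_def by measurable
  have bayes_le: "ennreal r \<le> ?R z" if "z \<in> space (sample_law n)" for z
    unfolding r(1)[symmetric] bayes_risk_def
    by (intro INF_lower H_measurable svm_mem space_sample_law lam that)
  \<comment> \<open>A deviation from the Bayes risk can only be upwards.\<close>
  have Ev_ge: "ennreal (r + e) \<le> ?R z" if z: "z \<in> Ev" for z
  proof (cases "?R z" rule: ennreal_cases)
    case (real s)
    have "r \<le> s"
      using bayes_le[of z] z real r(2) by (auto simp: Ev_def)
    moreover have "e < \<bar>s - r\<bar>"
      using z real r by (auto simp: Ev_def enn2ereal_ennreal)
    ultimately show ?thesis
      using real by (simp add: ennreal_leI)
  qed simp
  have "ennreal M * emeasure (sample_law n) (space (sample_law n) - W)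
      = (\<integral>\<^sup>+ z. ennreal M * indicator (space (sample_law n) - W) z \<partial>sample_law n)"
    by (rule nn_integral_cmult_indicator[symmetric]) measurable
  also have "\<dots> \<le> (\<integral>\<^sup>+ z. ennreal (zero_risk n z) \<partial>sample_law n)"
    by (intro nn_integral_mono) (auto simp: W_def ennreal_leI split: split_indicator)
  also have "\<dots> = ennreal c0"
    using nn_integral_emp_risk[OF n, of "\<lambda>x. 0"] by (simp add: zero_risk_def c0)
  finally have "M * measure (sample_law n) (space (sample_law n) - W) \<le> c0"
    using M c0(2) by (simp add: S.emeasure_eq_measure flip: ennreal_mult)
  then have Wc: "measure (sample_law n) (space (sample_law n) - W) \<le> c0 / M"
    using M by (simp add: field_simps)
  have PW: "measure (sample_law n) W \<ge> 1 - c0 / M"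
    using Wc S.prob_compl[OF W] by simp
  have "ennreal r * emeasure (sample_law n) W + ennreal e * emeasure (sample_law n) (W \<inter> Ev)
      = (\<integral>\<^sup>+ z. ennreal r * indicator W z + ennreal e * indicator (W \<inter> Ev) z \<partial>sample_law n)"
    by (subst nn_integral_add) (auto simp: nn_integral_cmult_indicator)
  also have "\<dots> \<le> (\<integral>\<^sup>+ z. (if zero_risk n z \<le> M then ?R z else 0) \<partial>sample_law n)"
  proof (rule nn_integral_mono)
    fix z assume z: "z \<in> space (sample_law n)"
    show "ennreal r * indicator W z + ennreal e * indicator (W \<inter> Ev) z
        \<le> (if zero_risk n z \<le> M then ?R z else 0)"
      using Ev_ge[of z] bayes_le[OF z] z r(2) e
      by (cases "z \<in> Ev"; cases "z \<in> W") (auto simp: W_def simp flip: ennreal_plus)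
  qed
  also have "\<dots> \<le> ennreal (r + \<theta>)"
    by (rule le)
  finally have "r * measure (sample_law n) W + e * measure (sample_law n) (W \<inter> Ev) \<le> r + \<theta>"
    using r(2) e \<theta> by (simp add: S.emeasure_eq_measure flip: ennreal_mult ennreal_plus)
  moreover have "r * (1 - c0 / M) \<le> r * measure (sample_law n) W"
    by (rule mult_left_mono[OF PW r(2)])
  ultimately have "e * measure (sample_law n) (W \<inter> Ev) \<le> r * c0 / M + \<theta>"
    by (simp add: algebra_simps)
  then have WE: "measure (sample_law n) (W \<inter> Ev) \<le> (r * c0 / M + \<theta>) / e"
    using e by (simp add: field_simps)
  have "measure (sample_law n) Ev \<le> measure (sample_law n) ((space (sample_law n) - W) \<union> (W \<inter> Ev))"
    by (rule S.finite_measure_mono) (auto simp: Ev_def)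
  also have "\<dots> \<le> measure (sample_law n) (space (sample_law n) - W) + measure (sample_law n) (W \<inter> Ev)"
    by (rule measure_Un_le) auto
  finally show ?thesis
    using Wc WE by linarith
qed

text \<open>The squared Lipschitz constant contributes \<open>lam powr (1 - p)\<close>, and strong
  convexity another factor \<open>1 / lam\<close>.\<close>

lemma stab_const_eq:
  assumes "0 < lam" "0 < A"
  shows "stab_const (A * lam powr (- 1 / 2)) lam n
    = \<kappa>\<^sup>2 * (lip * (2 * A) powr (p - 1))\<^sup>2 * inverse (lam powr p * real n)"
proof -
  have "(2 * (A * lam powr (- 1 / 2))) powr (p - 1) = (2 * A) powr (p - 1) * (lam powr (- 1 / 2)) powr (p - 1)"
    using assms by (simp add: powr_mult[symmetric] mult.assoc)
  moreover have "((lam powr (- 1 / 2)) powr (p - 1))\<^sup>2 = lam powr (1 - p)"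
    by (simp add: power2_eq_square powr_powr flip: powr_add)
  ultimately have "(lip * (2 * (A * lam powr (- 1 / 2))) powr (p - 1))\<^sup>2
      = (lip * (2 * A) powr (p - 1))\<^sup>2 * lam powr (1 - p)"
    by (simp add: power_mult_distrib)
  moreover have "lam powr (1 - p) = lam / lam powr p"
    using assms by (simp add: powr_diff)
  ultimately have *: "(lip * (2 * (A * lam powr (- 1 / 2))) powr (p - 1))\<^sup>2
      = (lip * (2 * A) powr (p - 1))\<^sup>2 * (lam / lam powr p)"
    by (simp only:)
  show ?thesis
    unfolding stab_const_def * using assms by (simp add: divide_inverse)
qed

lemma consistency:
  fixes lam :: "nat \<Rightarrow> real"
  assumes univ: "\<And>g e. continuous_on X g \<Longrightarrow> 0 < e \<Longrightarrow> \<exists>f\<in>H. \<forall>x\<in>X. \<bar>f x - g x\<bar> < e"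
    and lam_pos: "\<And>n. 1 \<le> n \<Longrightarrow> 0 < lam n" and lam_0: "lam \<longlonglongrightarrow> 0"
    and lam_p: "filterlim (\<lambda>n. lam n powr p * real n) at_top sequentially"
  shows "risk_consistent X L P (\<lambda>n. svm L H ip (lam n) n)"
  unfolding risk_consistent_def
proof (intro conjI allI impI)
  fix n :: nat assume "1 \<le> n"
  then show "(\<lambda>z. risk L P (svm L H ip (lam n) n z)) \<in> borel_measurable (sample_law n)"
    by (intro risk_svm_measurable lam_pos)
next
  fix e :: real assume e: "0 < e"
  let ?Ev = "\<lambda>n. {z \<in> space (sample_law n).
      \<bar>enn2ereal (risk L P (svm L H ip (lam n) n z)) - enn2ereal (bayes_risk X L P)\<bar> > ereal e}"
  have zero_meas: "(\<lambda>x. 0) \<in> borel_measurable (restrict_space borel X)"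
    by simp
  have "risk L P (\<lambda>x. 0) \<le> (\<integral>\<^sup>+ w. ennreal (c * ((0 + 2 * \<bar>snd w\<bar>) powr p + 1)) \<partial>P)"
    unfolding risk_eq by (intro nn_integral_mono ennreal_leI l_le_envelope) auto
  then have fin0: "risk L P (\<lambda>x. 0) < \<infinity>"
    using envelope_finite[of 0] by (simp add: order.strict_trans1)
  then obtain c0 where c0: "risk L P (\<lambda>x. 0) = ennreal c0" "0 \<le> c0"
    by (cases "risk L P (\<lambda>x. 0)" rule: ennreal_cases) auto
  have "bayes_risk X L P \<le> risk L P (\<lambda>x. 0)"
    unfolding bayes_risk_def by (rule INF_lower[OF zero_meas])
  then have "bayes_risk X L P < \<infinity>"
    using fin0 by (rule order.strict_trans1)
  then obtain r where r: "bayes_risk X L P = ennreal r" "0 \<le> r"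
    by (cases "bayes_risk X L P" rule: ennreal_cases) auto
  show "(\<lambda>n. measure (sample_law n) (?Ev n)) \<longlonglongrightarrow> 0"
  proof (rule tendstoI)
    fix \<delta> :: real assume \<delta>: "0 < \<delta>"
    \<comment> \<open>The excess \<open>2 * \<eta>\<close>, one \<open>\<eta>\<close> for
      approximation and one for \<open>err\<close>, costs \<open>\<delta> / 2\<close> after division
      by \<open>e\<close>. The choice of \<open>M\<close> keeps the terms due to truncation below
      \<open>\<delta> / 4\<close>.\<close>
    define \<eta> where "\<eta> = e * \<delta> / 4"
    have \<eta>: "0 < \<eta>"
      using e \<delta> by (simp add: \<eta>_def)
    define M where "M = max 1 (4 * (c0 + r * c0 / e) / \<delta>)"
    have M: "0 < M" "0 \<le> M"
      by (auto simp: M_def)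
    have "4 * (c0 + r * c0 / e) / \<delta> \<le> M"
      by (simp add: M_def)
    then have cM: "c0 / M + r * c0 / M / e \<le> \<delta> / 4"
      using M(1) \<delta> e by (simp add: field_simps)
    have "bayes_risk X L P < ennreal (r + \<eta> / 2)"
      using r \<eta> by (simp add: ennreal_less_iff)
    then obtain f where f: "f \<in> borel_measurable (restrict_space borel X)" "risk L P f < ennreal (r + \<eta> / 2)"
      unfolding bayes_risk_def by (auto simp: INF_less_iff)
    obtain h where h: "h \<in> H" "risk L P h \<le> risk L P f + ennreal (\<eta> / 2)"
      using risk_approx_H[OF univ f(1) less_trans[OF f(2)], of "\<eta> / 2"] \<eta> by auto
    have "risk L P h \<le> ennreal (r + \<eta> / 2) + ennreal (\<eta> / 2)"
      using h(2) f(2) by (meson add_right_mono less_imp_le order_trans)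
    then have h_le: "risk L P h \<le> ennreal (r + \<eta>)"
      using r(2) \<eta> by (simp add: add.commute flip: ennreal_plus)
    \<comment> \<open>This makes \<open>A * lam n powr (- 1 / 2)\<close> a valid bound
      \<open>B n\<close> for the estimator; the added \<open>1\<close> helps to give
      \<open>1 \<le> B n\<close> once \<open>lam n \<le> 1\<close>.\<close>
    define A where "A = \<kappa> * sqrt (M + 1) + 1"
    have A: "1 \<le> A"
      using \<kappa>_ge_1 M by (simp add: A_def)
    define B where "B n = A * lam n powr (- 1 / 2)" for n
    define q where "q n = inverse (lam n powr p * real n)" for n
    have q: "q \<longlonglongrightarrow> 0"
      unfolding q_def by (rule tendsto_inverse_0_at_top[OF lam_p])
    have ev1: "\<forall>\<^sub>F n in sequentially. 1 \<le> n \<and> 0 < lam n \<and> lam n \<le> 1"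
      using eventually_ge_at_top[of 1] order_tendstoD(2)[OF lam_0 zero_less_one]
      by eventually_elim (use lam_pos in auto)
    have inv_top: "filterlim (\<lambda>n. inverse (sqrt (lam n))) at_top sequentially"
      using ev1 tendsto_real_sqrt[OF lam_0]
      by (intro filterlim_inverse_at_top) (auto elim: eventually_mono)
    have "\<forall>\<^sub>F n in sequentially. inverse (sqrt (lam n)) = lam n powr (- 1 / 2)"
      using ev1 by eventually_elim (simp add: powr_minus powr_half_sqrt)
    then have "filterlim (\<lambda>n. lam n powr (- 1 / 2)) at_top sequentially"
      by (rule filterlim_cong[OF refl refl, THEN iffD1]) (rule inv_top)
    then have B_top: "filterlim B at_top sequentially"
      unfolding B_def using A by (intro filterlim_tendsto_pos_mult_at_top[OF tendsto_const]) auto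
    define err where "err n = ennreal (lam n * (hnorm ip h)\<^sup>2)
        + ennreal (stab_const (B n) (lam n) n) * (1 + shifted_moment) + tail (B n)" for n
    obtain s where s: "shifted_moment = ennreal s" "0 \<le> s"
      using shifted_moment_finite by (cases shifted_moment rule: ennreal_cases) auto
    have "(\<lambda>n. stab_const (B n) (lam n) n) \<longlonglongrightarrow> 0"
    proof (rule Lim_transform_eventually)
      show "(\<lambda>n. \<kappa>\<^sup>2 * (lip * (2 * A) powr (p - 1))\<^sup>2 * q n) \<longlonglongrightarrow> 0"
        using tendsto_mult_left[OF q] by simp
      show "\<forall>\<^sub>F n in sequentially. \<kappa>\<^sup>2 * (lip * (2 * A) powr (p - 1))\<^sup>2 * q n = stab_const (B n) (lam n) n"
        using ev1 by eventually_elim (unfold B_def q_def, rule stab_const_eq[symmetric], use A in auto)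
    qed
    then have "(\<lambda>n. ennreal (stab_const (B n) (lam n) n * (1 + s))) \<longlonglongrightarrow> ennreal (0 * (1 + s))"
      by (intro tendsto_ennrealI tendsto_intros)
    then have stab_lim: "(\<lambda>n. ennreal (stab_const (B n) (lam n) n) * (1 + shifted_moment)) \<longlonglongrightarrow> 0"
      using s by (simp add: ennreal_mult'' ennreal_plus flip: ennreal_1)
    have "(\<lambda>n. ennreal (lam n * (hnorm ip h)\<^sup>2)) \<longlonglongrightarrow> ennreal (0 * (hnorm ip h)\<^sup>2)"
      by (intro tendsto_ennrealI tendsto_intros lam_0)
    then have "err \<longlonglongrightarrow> 0 + 0 + 0"
      unfolding err_def by (intro tendsto_add stab_lim tail_tendsto_0 B_top) simp
    then have ev2: "\<forall>\<^sub>F n in sequentially. err n < ennreal \<eta>"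
      by (rule order_tendstoD) (use \<eta> in simp)
    \<comment> \<open>Prepares the condition \<open>c * (B n powr p + 1) \<le> n\<close>: for
      \<open>lam n \<le> 1\<close>, \<open>B n powr p\<close> is at most
      \<open>A powr p * lam n powr (- p)\<close>, which is
      \<open>A powr p * q n * n\<close>.\<close>
    have "(\<lambda>n. c * (A powr p * q n + inverse (real n))) \<longlonglongrightarrow> c * (A powr p * 0 + 0)"
      by (intro tendsto_intros q lim_inverse_n)
    then have ev3: "\<forall>\<^sub>F n in sequentially. c * (A powr p * q n + inverse (real n)) < 1"
      by (rule order_tendstoD) simp
    show "\<forall>\<^sub>F n in sequentially. dist (measure (sample_law n) (?Ev n)) 0 < \<delta>"
      using ev1 ev2 ev3
    proof eventually_elim
      case (elim n)
      then have n: "1 \<le> n" and l0: "0 < lam n" and l1: "lam n \<le> 1"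
        by auto
      have half: "lam n powr (- 1 / 2) = 1 / sqrt (lam n)"
        using l0 by (simp add: powr_minus powr_half_sqrt inverse_eq_divide)
      have inv_ge: "1 \<le> lam n powr (- 1 / 2)"
        unfolding half using l0 l1 by simp
      have B1: "1 \<le> B n"
        unfolding B_def using mult_mono[OF A inv_ge] A by simp
      have MB: "\<kappa> * sqrt ((M + 1) / lam n) \<le> B n"
        unfolding B_def half using l0 by (simp add: A_def real_sqrt_divide divide_right_mono)
      have "B n powr p = A powr p * lam n powr (- p / 2)"
        using A by (simp add: B_def powr_mult powr_powr)
      also have "\<dots> \<le> A powr p * lam n powr (- p)"
        using l0 l1 p_ge_1 by (intro mult_left_mono powr_mono') auto
      also have "\<dots> = A powr p * q n * real n"
        using n by (simp add: q_def powr_minus)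
      finally have "c * (B n powr p + 1) \<le> c * (A powr p * q n + inverse (real n)) * real n"
        using n c_pos by (simp add: algebra_simps)
      also have "\<dots> \<le> 1 * real n"
        using elim(3) by (intro mult_right_mono) auto
      finally have nB: "c * (B n powr p + 1) \<le> real n"
        by simp
      have "(\<integral>\<^sup>+ z. (if zero_risk n z \<le> M then risk L P (svm L H ip (lam n) n z) else 0) \<partial>sample_law n)
          \<le> risk L P h + err n"
        using expected_risk_le[OF n l0 M(2) B1 MB nB h(1)] by (simp add: err_def add.assoc)
      also have "\<dots> \<le> ennreal (r + \<eta>) + ennreal \<eta>"
        using h_le elim(2) by (intro add_mono) auto
      also have "\<dots> = ennreal (r + 2 * \<eta>)"
        using r(2) \<eta> by (simp flip: ennreal_plus)
      finally have "measure (sample_law n) (?Ev n) \<le> c0 / M + (r * c0 / M + 2 * \<eta>) / e"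
        using \<eta> by (intro deviation_prob_le n l0 M(1) e r c0) auto
      also have "\<dots> = (c0 / M + r * c0 / M / e) + \<delta> / 2"
        using e by (simp add: \<eta>_def field_simps)
      also have "\<dots> < \<delta>"
        using cM \<delta> by linarith
      finally show ?case
        by simp
    qed
  qed
qed

end

text \<open>The first conjunct justifies the definite description in \<open>svm\<close>: on every
  admissible sample it denotes the minimizer.\<close>

theorem theorem12:
  fixes X :: "(real ^ 'd) set"
    and Y :: "real set"
    and L :: "real \<Rightarrow> real \<Rightarrow> real"
    and p :: real
    and k :: "real ^ 'd \<Rightarrow> real ^ 'd \<Rightarrow> real"
    and H :: "(real ^ 'd \<Rightarrow> real) set"
    and ip :: "(real ^ 'd \<Rightarrow> real) \<Rightarrow> (real ^ 'd \<Rightarrow> real) \<Rightarrow> real"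
    and lam :: "nat \<Rightarrow> real"
  assumes "compact X"
    and "Y \<noteq> {}" and "closed Y"
    and "1 \<le> p"
    and "loss_function Y L" and "convex_loss Y L" and "invariant_loss Y L"
    and "lower_order Y L p" and "upper_order Y L p"
    and "universal_rkhs X k H ip"
    and "\<And>n. 1 \<le> n \<Longrightarrow> 0 < lam n"
    and "lam \<longlonglongrightarrow> 0"
    and "filterlim (\<lambda>n. lam n powr max (2 * p) (p\<^sup>2) * real n) at_top sequentially"
  shows "(\<forall>n\<ge>1. \<forall>z. (\<forall>i<n. z i \<in> X \<times> Y) \<longrightarrow> (\<exists>!f. reg_minimizer L H ip (lam n) n z f)) \<and>
         (\<forall>P. distribution_on X Y P \<and> moment p P < \<infinity> \<longrightarrow>
            risk_consistent X L P (\<lambda>n. svm L H ip (lam n) n))"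
proof -
  interpret rkhs X k H ip
    using assms(10) by (simp add: universal_rkhs_def)
  have cont_k: "continuous_on (X \<times> X) (\<lambda>(x, x'). k x x')"
    and cont_H: "\<And>f. f \<in> H \<Longrightarrow> continuous_on X f"
    and univ: "\<And>g e. continuous_on X g \<Longrightarrow> 0 < e \<Longrightarrow> \<exists>f\<in>H. \<forall>x\<in>X. \<bar>f x - g x\<bar> < e"
    using assms(10) by (auto simp: universal_rkhs_def)
  obtain l c where l: "represents_loss Y L l" and c: "0 < c" "\<And>r. l r \<le> c * (\<bar>r\<bar> powr p + 1)"
    using assms(9) by (auto simp: upper_order_def)
  obtain y0 where y0: "y0 \<in> Y"
    using assms(2) by blast
  \<comment> \<open>A single label suffices, because \<open>l r = L y0 (y0 - r)\<close> is
    \<open>L y0\<close> composed with an affine map.\<close>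
  have conv: "convex_on UNIV l"
  proof (rule convex_onI)
    fix t r s :: real assume t: "0 < t" "t < 1"
    have "L y0 ((1 - t) *\<^sub>R (y0 - r) + t *\<^sub>R (y0 - s)) \<le> (1 - t) * L y0 (y0 - r) + t * L y0 (y0 - s)"
      by (rule convex_onD) (use assms(6) y0 t in \<open>auto simp: convex_loss_def\<close>)
    moreover have "y0 - ((1 - t) *\<^sub>R (y0 - r) + t *\<^sub>R (y0 - s)) = (1 - t) *\<^sub>R r + t *\<^sub>R s"
      by (simp add: algebra_simps)
    ultimately show "l ((1 - t) *\<^sub>R r + t *\<^sub>R s) \<le> (1 - t) * l r + t * l s"
      using l y0 by (simp add: represents_loss_def)
  qed simp
  have "continuous_on X (\<lambda>x. case (x, x) of (x, x') \<Rightarrow> k x x')"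
    by (rule continuous_on_compose2[OF cont_k]) (auto intro!: continuous_intros)
  then have "continuous_on X (\<lambda>x. sqrt (k x x))"
    by (auto intro!: continuous_intros)
  then have "bounded ((\<lambda>x. sqrt (k x x)) ` X)"
    using assms(1) by (intro compact_imp_bounded compact_continuous_image)
  then obtain b where b: "\<And>x. x \<in> X \<Longrightarrow> \<bar>sqrt (k x x)\<bar> \<le> b"
    by (auto simp: bounded_iff)
  interpret svm_problem X k H ip Y L l c p "max 1 b"
  proof
    show "sqrt (k x x) \<le> max 1 b" if "x \<in> X" for x
      using b[OF that] by linarith
  qed (use assms(1,3,4) cont_k cont_H l c conv in \<open>auto simp: represents_loss_def\<close>)
  show ?thesis
  proof (intro conjI allI impI)
    fix n :: nat and z assume "1 \<le> n" "\<forall>i<n. z i \<in> X \<times> Y"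
    then show "\<exists>!f. reg_minimizer L H ip (lam n) n z f"
      by (intro reg_minimizer_ex1 assms(11)) (simp_all add: samples_def)
  next
    fix P assume P: "distribution_on X Y P \<and> moment p P < \<infinity>"
    interpret svm_sampling X k H ip Y L l c p "max 1 b" P
      by standard (use P in auto)
    show "risk_consistent X L P (\<lambda>n. svm L H ip (lam n) n)"
    proof (rule consistency[OF univ assms(11,12)])
      \<comment> \<open>Once \<open>lam n \<le> 1\<close>, a larger exponent gives a smaller power,
        so divergence passes down to the exponent \<open>p\<close>.\<close>
      have "\<forall>\<^sub>F n in sequentially. lam n powr max (2 * p) (p\<^sup>2) * real n \<le> lam n powr p * real n"
        using eventually_ge_at_top[of 1] order_tendstoD(2)[OF assms(12) zero_less_one]
      proof eventually_elim
        case (elim n)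
        then show ?case
          using assms(4) assms(11)[of n] by (intro mult_right_mono powr_mono') auto
      qed
      then show "filterlim (\<lambda>n. lam n powr p * real n) at_top sequentially"
        by (rule filterlim_at_top_mono[OF assms(13)])
    qed
  qed
qed

end
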